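(* Let $1<p<\infty$. There exists a constant $c=c(p)$, depending only on $p$, such that the following holds. Let $n\ge 1$, let $Q_0\subset\mathbb{R}^n$ be a cube, let $0<s\le \frac{1}{2^{n+3}}$ and $s\le r\le \frac12$. If $f\in JN^d_{p,0,s}(Q_0)$, then for every $\lambda>0$ \[ |\{x\in Q_0: |f(x)-m_f^{r}(Q_0)|>\lambda\}|\le c\,\frac{\|f\|_{JN^d_{p,0,s}(Q_0)}^p}{\lambda^p}. \]
   Context: $|A|$ denotes Lebesgue measure. A cube in $\mathbb{R}^n$ is a closed bounded cube $[a_1,b_1]\times\dots\times[a_n,b_n]$ with sides parallel to the coordinate axes and $b_1-a_1=\dots=b_n-a_n>0$. Dyadic subcubes: for a cube $Q_0$, $\mathcal{D}(Q_0)=\bigcup_{j=0}^\infty \mathcal{D}_j(Q_0)$, where $\mathcal{D}_j(Q_0)$ consists of the $2^{jn}$ closed cubes of side length $2^{-j}l(Q_0)$ ($l(Q_0)$ being the side length of $Q_0$), with pairwise disjoint interiors, obtained by dividing each side of $Q_0$ into $2^j$ equal parts. Elements of $\mathcal{D}(Q_0)$ are the dyadic subcubes of $Q_0$. Collections of dyadic cubes are called pairwise disjoint if their interiors are pairwise disjoint. Maximal median: for $0<s\le1$, a measurable set $A\subset\mathbb{R}^n$ with $0<|A|<\infty$ and a measurable function $f:A\to[-\infty,\infty]$, the maximal $s$-median of $f$ over $A$ is \[ m_f^s(A)=\inf\{a\in\mathbb{R}: |\{x\in A: f(x)>a\}|<s|A|\} \] (with $\inf\emptyset=+\infty$). Median-type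 dyadic John--Nirenberg space: for $1<p<\infty$ and $0<s\le\frac12$, a measurable function $f:Q_0\to[-\infty,\infty]$ belongs to $JN^d_{p,0,s}(Q_0)$ if \[ \|f\|_{JN^d_{p,0,s}(Q_0)}^p=\sup\sum_{i}|Q_i|\Bigl(\inf_{c_i\in\mathbb{R}} m_{|f-c_i|}^s(Q_i)\Bigr)^p<\infty, \] where the supremum is taken over countable collections $\{Q_i\}$ of pairwise disjoint dyadic subcubes of $Q_0$. *)

theory Defs
  imports "HOL-Analysis.Analysis"
begin

(* The constant in the theorem must not depend on the dimension n, so n has to be bound inside
   an existential quantifier and cannot be a type. Points of R^n are therefore functions in
   PiE {..<n} (\<lambda>_. UNIV), i.e. functions on {..<n} with value undefined elsewhere. *)

definition leb :: "nat \<Rightarrow> (nat \<Rightarrow> real) measure" where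
  "leb n = completion (PiM {..<n} (\<lambda>_. lborel))"

(* Only the coordinates a i with i < n of the lower corner a matter. *)
definition cube :: "nat \<Rightarrow> (nat \<Rightarrow> real) \<Rightarrow> real \<Rightarrow> (nat \<Rightarrow> real) set" where
  "cube n a l = PiE {..<n} (\<lambda>i. {a i .. a i + l})"

definition is_cube :: "nat \<Rightarrow> (nat \<Rightarrow> real) set \<Rightarrow> bool" where
  "is_cube n Q \<longleftrightarrow> (\<exists>a l. l > 0 \<and> Q = cube n a l)"

(* Interior with respect to R^n; the topology of the type nat \<Rightarrow> real would be the
   wrong one, since it has infinitely many coordinates. *)
definition cube_interior :: "nat \<Rightarrow> (nat \<Rightarrow> real) set \<Rightarrow> (nat \<Rightarrow> real) set" where
  "cube_interior n Q = product_topology (\<lambda>_. euclideanreal) {..<n} interior_of Q"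

definition dyadic_level :: "nat \<Rightarrow> nat \<Rightarrow> (nat \<Rightarrow> real) set \<Rightarrow> (nat \<Rightarrow> real) set set" where
  "dyadic_level n j Q0 =
     {cube n (\<lambda>i. a i + real (k i) * (l / 2 ^ j)) (l / 2 ^ j) | a l (k :: nat \<Rightarrow> nat).
        l > 0 \<and> Q0 = cube n a l \<and> (\<forall>i<n. k i < 2 ^ j)}"

definition dyadic_subcubes :: "nat \<Rightarrow> (nat \<Rightarrow> real) set \<Rightarrow> (nat \<Rightarrow> real) set set" where
  "dyadic_subcubes n Q0 = (\<Union>j. dyadic_level n j Q0)"

definition maximal_median ::
    "nat \<Rightarrow> real \<Rightarrow> ((nat \<Rightarrow> real) \<Rightarrow> ereal) \<Rightarrow> (nat \<Rightarrow> real) set \<Rightarrow> ereal" where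
  "maximal_median n s f A =
     Inf (ereal ` {a. emeasure (leb n) {x \<in> A. f x > ereal a} < ennreal s * emeasure (leb n) A})"

(* Real powers on [0, \<infinity>], used for exponents q > 0 only. *)
definition epowr :: "ennreal \<Rightarrow> real \<Rightarrow> ennreal" where
  "epowr x q = (if x = \<infinity> then \<infinity> else ennreal (enn2real x powr q))"

definition JN_sup ::
    "nat \<Rightarrow> real \<Rightarrow> real \<Rightarrow> (nat \<Rightarrow> real) set \<Rightarrow> ((nat \<Rightarrow> real) \<Rightarrow> ereal) \<Rightarrow> ennreal" where
  "JN_sup n p s Q0 f =
     (SUP C \<in> {C. C \<subseteq> dyadic_subcubes n Q0 \<and> countable C \<and>
                  pairwise (\<lambda>P Q. cube_interior n P \<inter> cube_interior n Q = {}) C}.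
        \<Sum>\<^sub>\<infinity>Q\<in>C. emeasure (leb n) Q *
          epowr (e2ennreal (INF c::real. maximal_median n s (\<lambda>x. \<bar>f x - ereal c\<bar>) Q)) p)"

definition JN_norm ::
    "nat \<Rightarrow> real \<Rightarrow> real \<Rightarrow> (nat \<Rightarrow> real) set \<Rightarrow> ((nat \<Rightarrow> real) \<Rightarrow> ereal) \<Rightarrow> ennreal" where
  "JN_norm n p s Q0 f = epowr (JN_sup n p s Q0 f) (1 / p)"

definition JN_space ::
    "nat \<Rightarrow> real \<Rightarrow> real \<Rightarrow> (nat \<Rightarrow> real) set \<Rightarrow> ((nat \<Rightarrow> real) \<Rightarrow> ereal) set" where
  "JN_space n p s Q0 =
     {f. f \<in> borel_measurable (restrict_space (leb n) Q0) \<and> JN_norm n p s Q0 f < \<infinity>}"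

end

theory Submission
  imports Defs
begin

text \<open>
  Write m for the r-median of f over the cube, N for 2^n, and call a dyadic cell dense at height u
  if |f - m| > u on at least the fraction 1/(4N) of it. Let E(u) be the union of the cells dense
  at height u. In a maximal such cell C other than the whole cube, the parent is not dense, so
  |f - m| is at most u on three quarters of C. If the s-oscillation of f over C is at most d, then
  f is d-close to some constant c off a set of relative measure s < 1/8, hence |m - c| is at most
  u + d, and |f - m| > u + 2d only on a set of relative measure s. As s is at most 1/(8N), cells
  dense at height u + 2d fill at most half of C. The cells with larger oscillation have total
  measure at most B/d^p, where B is the p-th power of the norm. Thus
  |E(u + 2d)| is at most |E(u)|/2 + B/d^p, and iterating this along a geometric sequence of heights
  with ratio (3/2)^(1/p) gives the weak-type bound with a constant depending on p only.
\<close>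

section \<open>Stopping cells\<close>

text \<open>The obstacle is a constant free of the dimension. A global comparison of E(u) with the
  superlevel set of |f - m| in both directions would cost a factor of order N. The recursion
  therefore runs on E(u) itself, and globally only one direction is needed: a point outside E(u)
  sees small density at every scale, so almost no such point has |f - m| > u. The other direction is
  used inside a single good cell, where the bound on s cancels N. The whole cube has no parent;
  there the median takes the role of the non-dense parent: it lies within d of every constant that
  is d-close to f off a fraction s, because s \<le> r \<le> 1/2. The iteration starts from the
  trivial bound by the measure of the cube, whose contribution is halved at each step and vanishes
  in the limit. With height ratio \<theta> the remaining error has the fixed point c = c *
  \<theta>^p / 2 + 1, and \<theta>^p = 3/2 gives c = 4. All this happens on an abstract nested
  partition of a finite measure space. Dyadic cubes enter through half-open cells, which differ from
  the closed cubes by null sets.\<close>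

lemma emeasure_Union_le:
  assumes "countable F" "F \<subseteq> sets M" "disjoint F"
    and A: "A \<in> sets M" and B: "B \<in> sets M" and D: "D \<in> sets M"
    and le: "\<And>C. C \<in> F \<Longrightarrow>
      a * emeasure M (A \<inter> C) \<le> b * emeasure M (B \<inter> C) + d * emeasure M (D \<inter> C)"
  shows "a * emeasure M (A \<inter> \<Union>F) \<le> b * emeasure M (B \<inter> \<Union>F) + d * emeasure M (D \<inter> \<Union>F)"
proof -
  have eq: "emeasure M (X \<inter> \<Union>F) = (\<integral>\<^sup>+C. emeasure M (X \<inter> C) \<partial>count_space F)" if "X \<in> sets M" for X
  proof -
    have "emeasure M (\<Union>((\<inter>) X ` F)) = (\<integral>\<^sup>+C. emeasure M (X \<inter> C) \<partial>count_space F)"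
      using assms(1-3) that
      by (intro emeasure_UN_countable) (auto simp: disjoint_family_on_def pairwise_def disjnt_def)
    then show ?thesis
      by simp
  qed
  show ?thesis
    unfolding eq[OF A] eq[OF B] eq[OF D]
    by (auto simp: nn_integral_cmult[symmetric] nn_integral_add[symmetric] le intro!: nn_integral_mono)
qed

text \<open>\<open>P j x\<close> is the cell of level j around x. The axiom
  \<open>cell_cover\<close> plays the part of outer regularity: S selects cells whose union covers A
  with little excess. In the application N is \<open>2 ^ n\<close>, the volume ratio of a cube to a
  dyadic child.\<close>

locale cell_filtration = finite_measure M for M :: "'a measure" +
  fixes P :: "nat \<Rightarrow> 'a \<Rightarrow> 'a set" and N :: real
  assumes cell_sets: "x \<in> space M \<Longrightarrow> P j x \<in> sets M"
    and cell_self: "x \<in> space M \<Longrightarrow> x \<in> P j x"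
    and cell_eq: "x \<in> space M \<Longrightarrow> y \<in> P j x \<Longrightarrow> P j y = P j x"
    and cell_Suc: "x \<in> space M \<Longrightarrow> P (Suc j) x \<subseteq> P j x"
    and cell_0: "x \<in> space M \<Longrightarrow> P 0 x = space M"
    and countable_cells: "countable (P j ` space M)"
    and cell_pos: "x \<in> space M \<Longrightarrow> 0 < measure M (P j x)"
    and cell_parent: "x \<in> space M \<Longrightarrow> measure M (P j x) \<le> N * measure M (P (Suc j) x)"
    and cell_cover: "A \<in> sets M \<Longrightarrow> 0 < e \<Longrightarrow>
      \<exists>S. A \<subseteq> {x \<in> space M. \<exists>j. S (P j x)} \<and> measure M {x \<in> space M. \<exists>j. S (P j x)} \<le> measure M A + e"
begin

section \<open>Stopping times and maximal cells\<close>

definition stopped :: "('a set \<Rightarrow> bool) \<Rightarrow> 'a set" where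
  "stopped S = {x \<in> space M. \<exists>j. S (P j x)}"

text \<open>A stopping time: cells shrink as the level grows, so the first level with S gives the
  maximal cell around x that satisfies S.\<close>

definition first_stop :: "('a set \<Rightarrow> bool) \<Rightarrow> nat \<Rightarrow> 'a \<Rightarrow> bool" where
  "first_stop S j x \<longleftrightarrow> x \<in> space M \<and> S (P j x) \<and> (\<forall>i<j. \<not> S (P i x))"

definition stop_cells :: "('a set \<Rightarrow> bool) \<Rightarrow> 'a set set" where
  "stop_cells S = {P j x | j x. first_stop S j x}"

lemma cell_space: "x \<in> space M \<Longrightarrow> P j x \<subseteq> space M"
  using cell_sets sets.sets_into_space by blast

lemma cell_antimono:
  assumes "x \<in> space M" "i \<le> j" shows "P j x \<subseteq> P i x"
  using assms(2) by (induction rule: dec_induct) (use cell_Suc[OF assms(1)] in auto)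

lemma cell_eq_le:
  assumes "x \<in> space M" "y \<in> P j x" "i \<le> j" shows "P i y = P i x"
  using cell_eq[OF assms(1)] cell_antimono[OF assms(1,3)] assms(2) by blast

text \<open>Points of one cell of level j share all ancestors, so the stopping time is constant on a
  stopping cell. Disjointness of the stopping cells rests on this.\<close>

lemma first_stop_cong:
  assumes "first_stop S j x" "y \<in> P j x" shows "first_stop S j y"
proof -
  have "x \<in> space M" using assms(1) by (simp add: first_stop_def)
  then have "y \<in> space M" "\<And>i. i \<le> j \<Longrightarrow> P i y = P i x"
    using cell_eq_le[OF _ assms(2)] cell_space assms(2) by blast+
  then show ?thesis
    using assms(1) by (simp add: first_stop_def)
qed

lemma first_stop_unique: "first_stop S i x \<Longrightarrow> first_stop S j x \<Longrightarrow> i = j"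
  unfolding first_stop_def by (meson nat_neq_iff)

lemma stop_cells_disjoint: "disjoint (stop_cells S)"
proof (rule disjointI)
  fix C D assume "C \<in> stop_cells S" "D \<in> stop_cells S" and ne: "C \<noteq> D"
  then obtain i x j y where C: "C = P i x" "first_stop S i x" and D: "D = P j y" "first_stop S j y"
    by (auto simp: stop_cells_def)
  show "C \<inter> D = {}"
  proof (rule ccontr)
    assume "C \<inter> D \<noteq> {}"
    then obtain z where z: "z \<in> P i x" "z \<in> P j y" using C D by auto
    have "i = j" using first_stop_cong[OF C(2) z(1)] first_stop_cong[OF D(2) z(2)] first_stop_unique by blast
    then have "P i x = P j y"
      using cell_eq z C(2) D(2) by (metis first_stop_def)
    then show False using ne C D by simp
  qed
qed

lemma stop_cells_subset: "stop_cells S \<subseteq> (\<Union>j. P j ` space M)"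
  by (auto simp: stop_cells_def first_stop_def)

lemma countable_stop_cells: "countable (stop_cells S)"
  by (rule countable_subset[OF stop_cells_subset]) (use countable_cells in auto)

lemma stop_cells_sets: "stop_cells S \<subseteq> sets M"
  using subset_trans[OF stop_cells_subset] cell_sets by blast

lemma first_stop_exists:
  assumes "x \<in> stopped S" obtains j where "first_stop S j x"
proof -
  have "\<exists>j. S (P j x)" "x \<in> space M" using assms by (auto simp: stopped_def)
  then have "first_stop S (LEAST j. S (P j x)) x"
    unfolding first_stop_def using LeastI_ex[of "\<lambda>j. S (P j x)"] not_less_Least[of _ "\<lambda>j. S (P j x)"] by blast
  then show ?thesis using that by blast
qed

lemma Union_stop_cells: "\<Union>(stop_cells S) = stopped S"
proof
  show "\<Union>(stop_cells S) \<subseteq> stopped S"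
  proof
    fix y assume "y \<in> \<Union>(stop_cells S)"
    then obtain j x where "first_stop S j x" "y \<in> P j x" by (auto simp: stop_cells_def)
    then have "first_stop S j y" by (rule first_stop_cong)
    then show "y \<in> stopped S" by (auto simp: stopped_def first_stop_def)
  qed
  show "stopped S \<subseteq> \<Union>(stop_cells S)"
  proof
    fix x assume x: "x \<in> stopped S"
    then obtain j where "first_stop S j x" by (rule first_stop_exists)
    moreover have "x \<in> P j x" using x cell_self by (simp add: stopped_def)
    ultimately show "x \<in> \<Union>(stop_cells S)" by (auto simp: stop_cells_def)
  qed
qed

lemma stopped_sets: "stopped S \<in> sets M"
  unfolding Union_stop_cells[symmetric] using stop_cells_sets countable_stop_cells
  by (intro sets.countable_Union) auto

lemma stop_cellsE:
  assumes "C \<in> stop_cells S"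
  obtains j x where "C = P j x" "first_stop S j x" "x \<in> space M"
  using assms by (auto simp: stop_cells_def first_stop_def)

text \<open>Local estimates on disjoint cells add up. Two terms on the right serve the good-lambda
  step, where B yields a fraction of every cell and D collects the bad cells; density estimates take
  d = 0.\<close>

lemma measure_Union_cells_le:
  assumes "countable F" "F \<subseteq> sets M" "disjoint F"
    and A: "A \<in> sets M" "B \<in> sets M" "D \<in> sets M"
    and nn: "0 \<le> a" "0 \<le> b" "0 \<le> d"
    and le: "\<And>C. C \<in> F \<Longrightarrow>
      a * measure M (A \<inter> C) \<le> b * measure M (B \<inter> C) + d * measure M (D \<inter> C)"
  shows "a * measure M (A \<inter> \<Union>F) \<le> b * measure M (B \<inter> \<Union>F) + d * measure M (D \<inter> \<Union>F)"
proof -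
  have "ennreal a * emeasure M (A \<inter> \<Union>F)
      \<le> ennreal b * emeasure M (B \<inter> \<Union>F) + ennreal d * emeasure M (D \<inter> \<Union>F)"
  proof (rule emeasure_Union_le[OF assms(1-6)])
    fix C assume "C \<in> F"
    from le[OF this] nn
    show "ennreal a * emeasure M (A \<inter> C)
        \<le> ennreal b * emeasure M (B \<inter> C) + ennreal d * emeasure M (D \<inter> C)"
      by (simp add: emeasure_eq_measure ennreal_mult[symmetric] ennreal_plus[symmetric] del: ennreal_plus)
  qed
  then show ?thesis
    using nn by (simp add: emeasure_eq_measure ennreal_mult[symmetric] ennreal_plus[symmetric] del: ennreal_plus)
qed

text \<open>Maximal cells do not overlap, so their densities average. This is the weak-type bound
  for the dyadic maximal function, with constant \<open>1 / t\<close> for positive t and no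
  dimensional factor.\<close>

lemma measure_stopped_le:
  assumes "A \<in> sets M" "0 \<le> t" and S: "\<And>x j. x \<in> space M \<Longrightarrow> S (P j x) \<Longrightarrow> t * measure M (P j x) \<le> measure M (A \<inter> P j x)"
  shows "t * measure M (stopped S) \<le> measure M (A \<inter> stopped S)"
proof -
  have "t * measure M (space M \<inter> \<Union>(stop_cells S)) \<le> 1 * measure M (A \<inter> \<Union>(stop_cells S)) + 0 * measure M (A \<inter> \<Union>(stop_cells S))"
  proof (rule measure_Union_cells_le[OF countable_stop_cells stop_cells_sets stop_cells_disjoint])
    fix C assume "C \<in> stop_cells S"
    then obtain j x where "C = P j x" "first_stop S j x" "x \<in> space M" by (rule stop_cellsE)
    then show "t * measure M (space M \<inter> C) \<le> 1 * measure M (A \<inter> C) + 0 * measure M (A \<inter> C)"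
      using S cell_space by (simp add: first_stop_def Int_absorb1)
  qed (use assms in auto)
  moreover have "space M \<inter> stopped S = stopped S" by (auto simp: stopped_def)
  ultimately show ?thesis by (simp add: Union_stop_cells)
qed

text \<open>This takes the place of the Lebesgue density theorem: covering A almost exactly by
  disjoint cells of density at most t would make A smaller than itself if its measure were
  positive.\<close>

lemma null_if_small_density:
  assumes A: "A \<in> sets M" and t: "0 < t" "t < 1"
    and small: "\<And>x j. x \<in> space M \<Longrightarrow> measure M (A \<inter> P j x) \<le> t * measure M (P j x)"
  shows "measure M A = 0"
proof (rule ccontr)
  assume "measure M A \<noteq> 0"
  then have pos: "measure M A > 0" by (simp add: zero_less_measure_iff)
  \<comment> \<open>The excess is chosen so that \<open>t * (measure M A + e)\<close> equals the
    midpoint value \<open>(1 + t) / 2 * measure M A\<close>, still below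
    \<open>measure M A\<close>.\<close>
  define e where "e = (1 / t - 1) * measure M A / 2"
  have e: "e > 0" using t pos by (simp add: e_def field_simps)
  obtain S where S: "A \<subseteq> stopped S" "measure M (stopped S) \<le> measure M A + e"
    using cell_cover[OF A e] unfolding stopped_def by blast
  have "1 * measure M (A \<inter> \<Union>(stop_cells S)) \<le> t * measure M (space M \<inter> \<Union>(stop_cells S)) + 0 * measure M (A \<inter> \<Union>(stop_cells S))"
  proof (rule measure_Union_cells_le[OF countable_stop_cells stop_cells_sets stop_cells_disjoint])
    fix C assume "C \<in> stop_cells S"
    then obtain j x where "C = P j x" "first_stop S j x" "x \<in> space M" by (rule stop_cellsE)
    then show "1 * measure M (A \<inter> C) \<le> t * measure M (space M \<inter> C) + 0 * measure M (A \<inter> C)"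
      using small cell_space by (simp add: Int_absorb1)
  qed (use A t in auto)
  moreover have "space M \<inter> stopped S = stopped S" by (auto simp: stopped_def)
  ultimately have "measure M A \<le> t * measure M (stopped S)"
    using S(1) by (simp add: Union_stop_cells Int_absorb2)
  also have "\<dots> \<le> t * (measure M A + e)"
    using S(2) t by simp
  also have "\<dots> = (1 + t) / 2 * measure M A"
    using t by (simp add: e_def field_simps)
  also have "\<dots> < 1 * measure M A"
    using t pos by (intro mult_strict_right_mono) auto
  finally show False by simp
qed

end

section \<open>The good-lambda inequality\<close>

text \<open>The hypotheses are free of medians and suprema: \<open>oscillation_bound\<close> is what
  a norm with p-th power B says about disjoint cells of oscillation at least d, and
  \<open>median\<close> is what the r-median m contributes on the whole space.\<close>

locale cell_oscillation = cell_filtration +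
  fixes f :: "'a \<Rightarrow> ereal" and s B p m :: real
  assumes f: "f \<in> borel_measurable M"
    and N: "1 \<le> N" and s: "0 < s" "s \<le> 1 / (8 * N)" and p: "1 < p" and B: "0 \<le> B"
    and oscillation_bound: "finite F \<Longrightarrow> F \<subseteq> (\<Union>j. P j ` space M) \<Longrightarrow> disjoint F \<Longrightarrow> 0 < d \<Longrightarrow>
      (\<And>C c. C \<in> F \<Longrightarrow> s * measure M C \<le> measure M {x \<in> C. \<bar>f x - ereal c\<bar> > ereal d}) \<Longrightarrow>
      (\<Sum>C\<in>F. measure M C) * d powr p \<le> B"
    and median: "0 < d \<Longrightarrow> measure M {x \<in> space M. \<bar>f x - ereal c\<bar> > ereal d} < s * measure M (space M) \<Longrightarrow>
      \<bar>m - c\<bar> \<le> d"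
begin

definition large :: "real \<Rightarrow> 'a set" where
  "large u = {x \<in> space M. \<bar>f x - ereal m\<bar> > ereal u}"

text \<open>The threshold 1/(4N) lies between the given bound s \<le> 1/(8N), a factor 2 below, and the
  value 1/N, at which passing from a cell to its parent would lose everything.\<close>

definition dense_cell :: "real \<Rightarrow> 'a set \<Rightarrow> bool" where
  "dense_cell u C \<longleftrightarrow> 1 / (4 * N) * measure M C \<le> measure M (large u \<inter> C)"

text \<open>This forces the infimum over c of the s-medians of |f - c| over C to be at least d. Its
  negation supplies a constant c with a strict bound on the exceptional set.\<close>

definition bad :: "real \<Rightarrow> 'a set \<Rightarrow> bool" where
  "bad d C \<longleftrightarrow> (\<forall>c. s * measure M C \<le> measure M {x \<in> C. \<bar>f x - ereal c\<bar> > ereal d})"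

section \<open>Measurability and monotonicity in the height\<close>

lemma superlevel_sets: "{x \<in> space M. \<bar>f x - ereal c\<bar> > ereal d} \<in> sets M"
proof -
  have [measurable]: "f \<in> borel_measurable M" by (rule f)
  show ?thesis by measurable
qed

lemma superlevel_cell_sets:
  assumes "C \<in> sets M" shows "{x \<in> C. \<bar>f x - ereal c\<bar> > ereal d} \<in> sets M"
proof -
  have "{x \<in> C. \<bar>f x - ereal c\<bar> > ereal d} = C \<inter> {x \<in> space M. \<bar>f x - ereal c\<bar> > ereal d}"
    using sets.sets_into_space[OF assms] by auto
  then show ?thesis using superlevel_sets assms by simp
qed

lemma large_sets: "large u \<in> sets M"
  unfolding large_def by (rule superlevel_sets)

lemma large_antimono: "u \<le> v \<Longrightarrow> large v \<subseteq> large u"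
  unfolding large_def by (auto intro: le_less_trans[of "ereal u" "ereal v"])

lemma dense_cell_mono:
  assumes "u \<le> v" "dense_cell v C" "C \<in> sets M" shows "dense_cell u C"
proof -
  have "measure M (large v \<inter> C) \<le> measure M (large u \<inter> C)"
    using large_antimono[OF assms(1)] large_sets assms(3) by (intro finite_measure_mono) auto
  then show ?thesis using assms(2) by (simp add: dense_cell_def)
qed

lemma stopped_dense_antimono: "u \<le> v \<Longrightarrow> stopped (dense_cell v) \<subseteq> stopped (dense_cell u)"
  using dense_cell_mono cell_sets by (fastforce simp: stopped_def)

text \<open>The oscillation bound speaks of finite families; continuity of the measure from below
  carries it over to countable ones.\<close>

lemma bad_Union_le:
  assumes F: "countable F" "F \<subseteq> (\<Union>j. P j ` space M)" "disjoint F" and d: "0 < d"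
    and bad: "\<And>C. C \<in> F \<Longrightarrow> bad d C"
  shows "measure M (\<Union>F) * d powr p \<le> B"
proof (cases "F = {}")
  case True
  then show ?thesis using B by simp
next
  case False
  \<comment> \<open>Initial segments of an enumeration of F. Repetitions are harmless, since
    \<open>G k\<close> is an image.\<close>
  define G where "G k = from_nat_into F ` {..k::nat}" for k
  have sub: "G k \<subseteq> F" for k
    using from_nat_into[OF False] by (auto simp: G_def)
  have sets: "C \<in> sets M" if "C \<in> F" for C
    using that F(2) cell_sets by blast
  have U: "(\<Union>k. \<Union>(G k)) = \<Union>F"
  proof
    show "(\<Union>k. \<Union>(G k)) \<subseteq> \<Union>F"
      using sub by blast
    show "\<Union>F \<subseteq> (\<Union>k. \<Union>(G k))"
    proof
      fix y assume "y \<in> \<Union>F"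
      then obtain C where "C \<in> F" "y \<in> C" by blast
      moreover then obtain k where "from_nat_into F k = C"
        using from_nat_into_surj[OF F(1)] by blast
      ultimately have "y \<in> \<Union>(G k)" unfolding G_def by blast
      then show "y \<in> (\<Union>k. \<Union>(G k))" by blast
    qed
  qed
  have "(\<lambda>k. measure M (\<Union>(G k))) \<longlonglongrightarrow> measure M (\<Union>k. \<Union>(G k))"
  proof (rule finite_Lim_measure_incseq)
    show "range (\<lambda>k. \<Union>(G k)) \<subseteq> sets M"
      using sub sets by (auto simp: G_def intro!: sets.finite_UN)
    show "incseq (\<lambda>k. \<Union>(G k))"
      by (force simp: incseq_def G_def)
  qed
  then have lim: "(\<lambda>k. measure M (\<Union>(G k)) * d powr p) \<longlonglongrightarrow> measure M (\<Union>F) * d powr p"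
    unfolding U by (intro tendsto_intros)
  have "measure M (\<Union>(G k)) * d powr p \<le> B" for k
  proof -
    have disj: "disjoint (G k)"
      using F(3) sub by (rule pairwise_subset)
    have "measure M (\<Union>(G k)) = (\<Sum>C\<in>G k. measure M C)"
      using disj sub sets by (intro measure_Union') (auto simp: G_def fmeasurable_eq_sets)
    moreover have "(\<Sum>C\<in>G k. measure M C) * d powr p \<le> B"
    proof (rule oscillation_bound[OF _ subset_trans[OF sub F(2)] disj d])
      show "finite (G k)" by (simp add: G_def)
    next
      fix C c assume "C \<in> G k"
      then have "bad d C" using sub bad by blast
      then show "s * measure M C \<le> measure M {x \<in> C. \<bar>f x - ereal c\<bar> > ereal d}"
        by (simp add: bad_def)
    qed
    ultimately show ?thesis by simp
  qed
  then show ?thesis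
    using lim by (intro LIMSEQ_le_const2) auto
qed

lemma good_cell_stopped_le:
  assumes C: "C \<in> stop_cells (dense_cell u)" and u: "0 < u" "0 < d" and good: "\<not> bad d C"
  shows "2 * measure M (stopped (dense_cell (u + 2 * d)) \<inter> C) \<le> measure M C"
proof -
  obtain j x where jx: "C = P j x" "first_stop (dense_cell u) j x" "x \<in> space M"
    using C by (rule stop_cellsE)
  have Cs: "C \<in> sets M" and Csp: "C \<subseteq> space M" using jx cell_sets cell_space by auto
  have pos: "measure M C > 0" using jx cell_pos by simp
  obtain c where c: "measure M {x \<in> C. \<bar>f x - ereal c\<bar> > ereal d} < s * measure M C"
    using good by (auto simp: bad_def not_le)
  have cm: "\<bar>m - c\<bar> \<le> u + d"
  proof (cases j)
    case 0
    then have "C = space M" using jx cell_0 by simp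
    then have "\<bar>m - c\<bar> \<le> d" using c median u by simp
    then show ?thesis using u by simp
  next
    case (Suc i)
    have "\<not> dense_cell u (P i x)" using jx(2) Suc by (simp add: first_stop_def)
    then have "measure M (large u \<inter> P i x) < 1 / (4 * N) * measure M (P i x)"
      by (simp add: dense_cell_def)
    also have "\<dots> \<le> 1 / (4 * N) * (N * measure M C)"
      using cell_parent[OF jx(3), of i] N unfolding jx(1) Suc by (intro mult_left_mono) auto
    also have "\<dots> = measure M C / 4"
      using N by simp
    finally have 1: "measure M (large u \<inter> P i x) < measure M C / 4" .
    have "measure M (large u \<inter> C) \<le> measure M (large u \<inter> P i x)"
      using cell_Suc[OF jx(3)] large_sets cell_sets[OF jx(3)] unfolding jx(1) Suc
      by (intro finite_measure_mono) auto
    with 1 have 2: "measure M (large u \<inter> C) < measure M C / 4" by simp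
    have "s \<le> 1 / 8"
      using s(2) N by (smt (verit) frac_le)
    then have 3: "s * measure M C \<le> 1 / 8 * measure M C"
      using pos by (intro mult_right_mono) auto
    \<comment> \<open>The exceptional sets fill less than 1/4 + 1/8 of C, so some y escapes both.
      There \<open>f y\<close> is finite, and the triangle inequality through \<open>f y\<close>
      compares m with c.\<close>
    have "\<not> C \<subseteq> (large u \<inter> C) \<union> {x \<in> C. \<bar>f x - ereal c\<bar> > ereal d}"
    proof
      assume "C \<subseteq> (large u \<inter> C) \<union> {x \<in> C. \<bar>f x - ereal c\<bar> > ereal d}"
      then have "measure M C \<le> measure M ((large u \<inter> C) \<union> {x \<in> C. \<bar>f x - ereal c\<bar> > ereal d})"
        using large_sets superlevel_cell_sets[OF Cs] Cs by (intro finite_measure_mono) auto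
      also have "\<dots> \<le> measure M (large u \<inter> C) + measure M {x \<in> C. \<bar>f x - ereal c\<bar> > ereal d}"
        using large_sets superlevel_cell_sets[OF Cs] Cs by (intro measure_Un_le) auto
      finally show False using 2 3 c pos by simp
    qed
    then obtain y where y': "y \<in> C" "y \<notin> large u" "\<not> \<bar>f y - ereal c\<bar> > ereal d"
      by blast
    then have y: "\<bar>f y - ereal m\<bar> \<le> ereal u" "\<bar>f y - ereal c\<bar> \<le> ereal d"
      using Csp unfolding large_def by (auto simp only: mem_Collect_eq not_less)
    then obtain v where "f y = ereal v" by (cases "f y") auto
    then show ?thesis using y by auto
  qed
  define w where "w = u + 2 * d"
  define A where "A = {x \<in> C. \<bar>f x - ereal c\<bar> > ereal d}"
  have As: "A \<in> sets M" unfolding A_def by (rule superlevel_cell_sets[OF Cs])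
  \<comment> \<open>If |f - c| \<le> d, then |f - m| \<le> d + (u + d) = w. At infinite values of f
    both inequalities defining the sets hold.\<close>
  have largeA: "large w \<inter> C \<subseteq> A"
  proof
    fix y assume y: "y \<in> large w \<inter> C"
    show "y \<in> A"
    proof (cases "f y")
      case (real v)
      then show ?thesis using y cm by (auto simp: large_def A_def w_def)
    qed (use y in \<open>auto simp: A_def\<close>)
  qed
  \<comment> \<open>Cells dense at height w that meet C lie inside C: they are dense at height u as
    well, hence not strict ancestors of a cell that stopped first. Restricting to subcells of C
    makes the density estimate local.\<close>
  define S where "S X \<longleftrightarrow> dense_cell w X \<and> X \<subseteq> C" for X
  have st: "1 / (8 * N) \<le> 1 / (4 * N)" using N by (simp add: field_simps)
  have notC: "\<not> dense_cell w C"
  proof -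
    have "measure M (large w \<inter> C) \<le> measure M A"
      using largeA As by (intro finite_measure_mono)
    also have "\<dots> < s * measure M C" using c by (simp add: A_def)
    also have "\<dots> \<le> 1 / (4 * N) * measure M C"
      using s(2) st pos by (intro mult_right_mono) auto
    finally show ?thesis by (simp add: dense_cell_def)
  qed
  have sub: "stopped (dense_cell w) \<inter> C \<subseteq> stopped S"
  proof
    fix y assume y: "y \<in> stopped (dense_cell w) \<inter> C"
    then have ysp: "y \<in> space M" using Csp by auto
    have fy: "first_stop (dense_cell u) j y"
      using jx y by (intro first_stop_cong[OF jx(2)]) auto
    have PC: "P j y = C" using jx y cell_eq by auto
    obtain i where i: "dense_cell w (P i y)" using y by (auto simp: stopped_def)
    have "dense_cell u (P i y)"
      using dense_cell_mono[OF _ i cell_sets[OF ysp]] u by (simp add: w_def)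
    then have "\<not> i < j" using fy by (auto simp: first_stop_def)
    then have "P i y \<subseteq> C" using cell_antimono[OF ysp, of j i] PC by simp
    then show "y \<in> stopped S" using i ysp by (auto simp: stopped_def S_def)
  qed
  have "1 / (4 * N) * measure M (stopped S) \<le> measure M (A \<inter> stopped S)"
  proof (rule measure_stopped_le[OF As])
    fix x j assume x: "x \<in> space M" "S (P j x)"
    have "measure M (large w \<inter> P j x) \<le> measure M (A \<inter> P j x)"
      using x largeA As cell_sets by (intro finite_measure_mono) (auto simp: S_def)
    then show "1 / (4 * N) * measure M (P j x) \<le> measure M (A \<inter> P j x)"
      using x by (simp add: S_def dense_cell_def)
  qed (use N in auto)
  also have "\<dots> \<le> measure M A"
    using As by (intro finite_measure_mono) auto
  also have "\<dots> \<le> s * measure M C" using c by (simp add: A_def)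
  also have "\<dots> \<le> 1 / (8 * N) * measure M C" using s pos by (intro mult_right_mono) auto
  \<comment> \<open>The thresholds \<open>1 / (4 * N)\<close> and \<open>1 / (8 * N)\<close> differ
    by the factor 2 gained here, and N cancels.\<close>
  finally have "2 * measure M (stopped S) \<le> measure M C" using N by (simp add: field_simps)
  moreover have "measure M (stopped (dense_cell w) \<inter> C) \<le> measure M (stopped S)"
    using sub stopped_sets by (intro finite_measure_mono) auto
  ultimately show ?thesis by (simp add: w_def)
qed

lemma good_lambda:
  assumes u: "0 < u" "0 < d"
  shows "measure M (stopped (dense_cell (u + 2 * d))) \<le> measure M (stopped (dense_cell u)) / 2 + B / d powr p"
proof -
  define F where "F = stop_cells (dense_cell u)"
  define U where "U = \<Union>{C \<in> F. bad d C}"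
  define E where "E = stopped (dense_cell (u + 2 * d))"
  have E: "E \<in> sets M" by (simp add: E_def stopped_sets)
  have U: "U \<in> sets M"
    unfolding U_def F_def using stop_cells_sets countable_stop_cells
    by (intro sets.countable_Union) (auto intro: countable_subset)
  have "1 * measure M (E \<inter> \<Union>F) \<le> 1 / 2 * measure M (space M \<inter> \<Union>F) + 1 * measure M (U \<inter> \<Union>F)"
    unfolding F_def
  proof (rule measure_Union_cells_le[OF countable_stop_cells stop_cells_sets stop_cells_disjoint])
    fix C assume C: "C \<in> stop_cells (dense_cell u)"
    then have Cs: "C \<in> sets M" using stop_cells_sets by auto
    then have sp: "space M \<inter> C = C" using sets.sets_into_space by blast
    show "1 * measure M (E \<inter> C) \<le> 1 / 2 * measure M (space M \<inter> C) + 1 * measure M (U \<inter> C)"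
    proof (cases "bad d C")
      case True
      then have UC: "U \<inter> C = C" using C by (auto simp: U_def F_def)
      have "measure M (E \<inter> C) \<le> measure M C" using Cs by (intro finite_measure_mono) auto
      moreover have "0 \<le> measure M C" by simp
      ultimately show ?thesis unfolding sp UC by linarith
    next
      case False
      have "2 * measure M (E \<inter> C) \<le> measure M C"
        unfolding E_def by (rule good_cell_stopped_le[OF C u False])
      moreover have "0 \<le> measure M (U \<inter> C)" by simp
      ultimately show ?thesis unfolding sp by linarith
    qed
  qed (use E U in auto)
  \<comment> \<open>A point stopped at the greater height is stopped at height u too, so the sum
    over the cells of F misses nothing of E.\<close>
  moreover have "E \<inter> \<Union>F = E"
    using stopped_dense_antimono[of u "u + 2 * d"] u by (auto simp: F_def Union_stop_cells E_def)
  moreover have "space M \<inter> \<Union>F = stopped (dense_cell u)"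
    by (auto simp: F_def Union_stop_cells stopped_def)
  moreover have "measure M (U \<inter> \<Union>F) \<le> B / d powr p"
  proof -
    have "measure M U * d powr p \<le> B"
      unfolding U_def
    proof (rule bad_Union_le)
      show "countable {C \<in> F. bad d C}"
        using countable_stop_cells by (auto simp: F_def intro: countable_subset)
      show "disjoint {C \<in> F. bad d C}"
        using stop_cells_disjoint[of "dense_cell u"] unfolding F_def by (rule pairwise_subset) auto
      show "{C \<in> F. bad d C} \<subseteq> (\<Union>j. P j ` space M)"
        using stop_cells_subset unfolding F_def by blast
    qed (use u in auto)
    moreover have "U \<inter> \<Union>F = U" by (auto simp: U_def)
    ultimately show ?thesis using u by (simp add: field_simps)
  qed
  ultimately show ?thesis by (simp add: E_def)
qed

text \<open>A cell that contains a point outside E is not dense, so the part of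
  \<open>large u\<close> outside E has density at most \<open>1 / (4 * N)\<close> in every cell and
  is null.\<close>

lemma large_le_stopped:
  "measure M (large u) \<le> measure M (stopped (dense_cell u))"
proof -
  define E where "E = stopped (dense_cell u)"
  have E: "E \<in> sets M" by (simp add: E_def stopped_sets)
  have "measure M (large u - E) = 0"
  proof (rule null_if_small_density[where t = "1 / (4 * N)"])
    fix x j assume x: "x \<in> space M"
    show "measure M ((large u - E) \<inter> P j x) \<le> 1 / (4 * N) * measure M (P j x)"
    proof (cases "(large u - E) \<inter> P j x = {}")
      case True
      then show ?thesis using N by simp
    next
      case False
      then obtain y where y: "y \<in> P j x" "y \<notin> E" by auto
      then have "P j y = P j x" "y \<in> space M" using x cell_eq cell_space by blast+
      then have "\<not> dense_cell u (P j x)" using y by (metis (mono_tags) CollectI E_def stopped_def)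
      moreover have "measure M ((large u - E) \<inter> P j x) \<le> measure M (large u \<inter> P j x)"
        using large_sets x cell_sets by (intro finite_measure_mono) auto
      ultimately show ?thesis by (simp add: dense_cell_def)
    qed
  qed (use N large_sets E in auto)
  moreover have "measure M (large u) \<le> measure M ((large u - E) \<union> E)"
    using large_sets E by (intro finite_measure_mono) auto
  moreover have "\<dots> \<le> measure M (large u - E) + measure M E"
    using large_sets E by (intro measure_Un_le) auto
  ultimately show ?thesis by (simp add: E_def)
qed

lemma weak_type:
  assumes u: "0 < u"
  defines "\<theta> \<equiv> (3 / 2) powr (1 / p)"
  shows "measure M (large u) \<le> 4 * (2 * \<theta> / (\<theta> - 1)) powr p * (B / u powr p)"
proof -
  define K where "K = (2 * \<theta> / (\<theta> - 1)) powr p * B"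
  have \<theta>: "\<theta> > 1" "\<theta> powr p = 3 / 2"
    using p by (auto simp: \<theta>_def powr_powr)
  \<comment> \<open>The height v must be arbitrary in the induction on k, since each step lowers it
    to \<open>v / \<theta>\<close>.\<close>
  have step: "measure M (stopped (dense_cell v)) \<le> (1 / 2) ^ k * measure M (space M) + 4 * K / v powr p"
    if "0 < v" for v k
    using that
  proof (induction k arbitrary: v)
    case 0
    have "measure M (stopped (dense_cell v)) \<le> measure M (space M)"
      by (simp add: bounded_measure)
    moreover have "0 \<le> 4 * K / v powr p" using B by (simp add: K_def)
    ultimately show ?case by simp
  next
    case (Suc k)
    \<comment> \<open>Solves \<open>v / \<theta> + 2 * d = v\<close>. As d is proportional to v,
      \<open>B / d powr p\<close> is the multiple K of \<open>1 / v powr p\<close>.\<close>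
    define d where "d = (\<theta> - 1) * (v / \<theta>) / 2"
    have d: "d > 0" "v / \<theta> > 0" "v / \<theta> + 2 * d = v"
      using \<theta> Suc.prems by (auto simp: d_def field_simps)
    have eq: "B / d powr p = K / v powr p"
    proof -
      have "v / d = 2 * \<theta> / (\<theta> - 1)"
        using \<theta> Suc.prems by (simp add: d_def field_simps)
      then have "(2 * \<theta> / (\<theta> - 1)) powr p = v powr p / d powr p"
        using Suc.prems d by (simp add: powr_divide[symmetric])
      then show ?thesis using Suc.prems by (simp add: K_def)
    qed
    have "(v / \<theta>) powr p = v powr p / (3 / 2)"
      using \<theta>(1) Suc.prems by (simp add: powr_divide \<theta>(2))
    then have IH: "measure M (stopped (dense_cell (v / \<theta>))) \<le> (1 / 2) ^ k * measure M (space M) + 6 * K / v powr p"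
      using Suc.IH[OF d(2)] unfolding \<open>(v / \<theta>) powr p = v powr p / (3 / 2)\<close> by simp
    \<comment> \<open>Half of the inherited error 6K plus the new K is again 4K.\<close>
    show ?case
      using good_lambda[OF d(2,1)] IH unfolding d(3) eq times_divide_eq_right[symmetric] power_Suc
      by linarith
  qed
  have "(\<lambda>k. (1 / 2) ^ k * measure M (space M) + 4 * K / u powr p) \<longlonglongrightarrow> 0 * measure M (space M) + 4 * K / u powr p"
    by (intro tendsto_intros LIMSEQ_power_zero) auto
  then have "measure M (stopped (dense_cell u)) \<le> 0 * measure M (space M) + 4 * K / u powr p"
    by (rule LIMSEQ_le_const) (use step[OF u] in auto)
  then show ?thesis
    using large_le_stopped[of u] by (simp add: K_def)
qed

end

section \<open>Half-open dyadic cells\<close>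

definition half_open_cube :: "nat \<Rightarrow> (nat \<Rightarrow> real) \<Rightarrow> real \<Rightarrow> (nat \<Rightarrow> real) set" where
  "half_open_cube n a l = PiE {..<n} (\<lambda>i. {a i ..< a i + l})"

lemma
  assumes "0 \<le> l"
  shows half_open_cube_sets: "half_open_cube n a l \<in> sets (PiM {..<n} (\<lambda>_. lborel))"
    and cube_sets: "cube n a l \<in> sets (PiM {..<n} (\<lambda>_. lborel))"
    and emeasure_half_open_cube: "emeasure (leb n) (half_open_cube n a l) = ennreal (l ^ n)"
    and emeasure_cube: "emeasure (leb n) (cube n a l) = ennreal (l ^ n)"
proof -
  interpret product_sigma_finite "\<lambda>_::nat. lborel :: real measure" ..
  show *: "half_open_cube n a l \<in> sets (PiM {..<n} (\<lambda>_. lborel))"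
    "cube n a l \<in> sets (PiM {..<n} (\<lambda>_. lborel))"
    unfolding half_open_cube_def cube_def by (auto intro!: sets_PiM_I_finite)
  show "emeasure (leb n) (half_open_cube n a l) = ennreal (l ^ n)"
    using * assms unfolding half_open_cube_def leb_def
    by (subst emeasure_completion) (auto simp: emeasure_PiM ennreal_power)
  show "emeasure (leb n) (cube n a l) = ennreal (l ^ n)"
    using * assms unfolding cube_def leb_def
    by (subst emeasure_completion) (auto simp: emeasure_PiM ennreal_power)
qed

lemma leb_setsI: "A \<in> sets (PiM {..<n} (\<lambda>_. lborel)) \<Longrightarrow> A \<in> sets (leb n)"
  by (simp add: leb_def)

lemma half_open_cube_subset: "half_open_cube n a l \<subseteq> cube n a l"
  unfolding half_open_cube_def cube_def by (rule PiE_mono) auto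

text \<open>An open box around x inside the cube has open factors, which avoid the right endpoints.
  Hence disjoint half-open cells give closed cubes with disjoint interiors, as the norm
  demands.\<close>

lemma cube_interior_subset: "cube_interior n (cube n a l) \<subseteq> half_open_cube n a l"
proof
  fix x assume "x \<in> cube_interior n (cube n a l)"
  then obtain T where T: "openin (product_topology (\<lambda>_. euclideanreal) {..<n}) T" "x \<in> T" "T \<subseteq> cube n a l"
    by (auto simp: cube_interior_def interior_of_def)
  obtain X where X: "x \<in> PiE {..<n} X" "\<And>i. open (X i)" "PiE {..<n} X \<subseteq> cube n a l"
    using product_topology_open_contains_basis[OF T(1,2)] T(3)
    unfolding open_openin[symmetric] by blast
  have "x i \<in> {a i ..< a i + l}" if "i < n" for i
  proof -
    have "X i \<subseteq> {a i .. a i + l}"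
      using X(1,3) that unfolding cube_def by (auto simp: subset_PiE)
    then have "X i \<subseteq> interior {a i .. a i + l}" by (rule interior_maximal[OF _ X(2)])
    then show ?thesis using X(1) that by (auto simp: PiE_iff)
  qed
  then show "x \<in> half_open_cube n a l"
    using X(1) by (auto simp: half_open_cube_def PiE_iff)
qed

text \<open>Any two half-open cells are nested or disjoint, which fails on the boundary for closed cubes.\<close>

definition cell_index :: "(nat \<Rightarrow> real) \<Rightarrow> real \<Rightarrow> nat \<Rightarrow> (nat \<Rightarrow> real) \<Rightarrow> nat \<Rightarrow> nat" where
  "cell_index a l j x i = nat \<lfloor>(x i - a i) * 2 ^ j / l\<rfloor>"

definition cell_corner :: "(nat \<Rightarrow> real) \<Rightarrow> real \<Rightarrow> nat \<Rightarrow> (nat \<Rightarrow> real) \<Rightarrow> nat \<Rightarrow> real" where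
  "cell_corner a l j x i = a i + real (cell_index a l j x i) * (l / 2 ^ j)"

definition dyadic_cell :: "nat \<Rightarrow> (nat \<Rightarrow> real) \<Rightarrow> real \<Rightarrow> nat \<Rightarrow> (nat \<Rightarrow> real) \<Rightarrow> (nat \<Rightarrow> real) set" where
  "dyadic_cell n a l j x = half_open_cube n (cell_corner a l j x) (l / 2 ^ j)"

section \<open>Cells as classes of points with equal floors; outer approximation\<close>

context
  fixes n :: nat and a :: "nat \<Rightarrow> real" and l :: real
  assumes l: "0 < l"
begin

lemma scaled_bounds:
  assumes "x \<in> half_open_cube n a l" "i < n"
  shows "0 \<le> (x i - a i) * 2 ^ j / l" "(x i - a i) * 2 ^ j / l < 2 ^ j"
proof -
  have "a i \<le> x i" "x i < a i + l" using assms by (auto simp: half_open_cube_def PiE_iff)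
  then show "0 \<le> (x i - a i) * 2 ^ j / l" "(x i - a i) * 2 ^ j / l < 2 ^ j"
    using l by (auto simp: divide_less_eq mult.commute[of _ "2 ^ j"])
qed

lemma cell_index_less:
  assumes "x \<in> half_open_cube n a l" "i < n"
  shows "cell_index a l j x i < 2 ^ j"
proof -
  define u where "u = (x i - a i) * 2 ^ j / l"
  have "0 \<le> \<lfloor>u\<rfloor>" "\<lfloor>u\<rfloor> < int (2 ^ j)"
    using scaled_bounds[OF assms, of j] unfolding u_def[symmetric] by (auto simp: floor_less_iff)
  then show ?thesis
    unfolding cell_index_def u_def[symmetric] by (subst nat_less_iff)
qed

lemma mem_cell_coordinate:
  assumes x: "x \<in> half_open_cube n a l" "i < n"
  shows "y i \<in> {cell_corner a l j x i ..< cell_corner a l j x i + l / 2 ^ j} \<longleftrightarrow>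
    \<lfloor>(y i - a i) * 2 ^ j / l\<rfloor> = \<lfloor>(x i - a i) * 2 ^ j / l\<rfloor>"
proof -
  define k where "k = \<lfloor>(x i - a i) * 2 ^ j / l\<rfloor>"
  have "real (cell_index a l j x i) = of_int k"
    using scaled_bounds(1)[OF x, of j] by (simp add: cell_index_def k_def)
  then have "y i \<in> {cell_corner a l j x i ..< cell_corner a l j x i + l / 2 ^ j} \<longleftrightarrow>
      of_int k \<le> (y i - a i) * 2 ^ j / l \<and> (y i - a i) * 2 ^ j / l < of_int k + 1"
    using l unfolding cell_corner_def by (simp add: field_simps)
  then show ?thesis by (simp add: floor_eq_iff k_def)
qed

text \<open>Cells become equivalence classes, so nesting is reduced to arithmetic of floors. Equal
  floors already force y into the big cube, because those of x lie between 0 and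
  \<open>2 ^ j - 1\<close>.\<close>

lemma mem_dyadic_cell:
  assumes x: "x \<in> half_open_cube n a l"
  shows "y \<in> dyadic_cell n a l j x \<longleftrightarrow> y \<in> half_open_cube n a l \<and>
    (\<forall>i<n. \<lfloor>(y i - a i) * 2 ^ j / l\<rfloor> = \<lfloor>(x i - a i) * 2 ^ j / l\<rfloor>)"
proof -
  have bounds: "y i \<in> {a i ..< a i + l}"
    if "i < n" and eq: "\<lfloor>(y i - a i) * 2 ^ j / l\<rfloor> = \<lfloor>(x i - a i) * 2 ^ j / l\<rfloor>" for i
  proof -
    have "0 \<le> \<lfloor>(y i - a i) * 2 ^ j / l\<rfloor>" "\<lfloor>(y i - a i) * 2 ^ j / l\<rfloor> < 2 ^ j"
      using scaled_bounds[OF x \<open>i < n\<close>, of j] unfolding eq by (auto simp: floor_less_iff)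
    then have "0 \<le> (y i - a i) * 2 ^ j / l" "(y i - a i) * 2 ^ j / l < 2 ^ j"
      by (auto simp: floor_less_iff)
    then have "0 \<le> (y i - a i) * 2 ^ j" "(y i - a i) * 2 ^ j < l * 2 ^ j"
      using l by (simp_all add: zero_le_divide_iff divide_less_eq mult.commute[of l])
    moreover have "(0::real) < 2 ^ j" by simp
    ultimately have "0 \<le> y i - a i" "y i - a i < l"
      by (auto simp only: zero_le_mult_iff mult_less_cancel_right)
    then show ?thesis by simp
  qed
  have "y \<in> dyadic_cell n a l j x \<longleftrightarrow> y \<in> extensional {..<n} \<and>
    (\<forall>i<n. \<lfloor>(y i - a i) * 2 ^ j / l\<rfloor> = \<lfloor>(x i - a i) * 2 ^ j / l\<rfloor>)"
    using mem_cell_coordinate[OF x] unfolding dyadic_cell_def half_open_cube_def by (auto simp: PiE_iff)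
  moreover have "y \<in> half_open_cube n a l \<longleftrightarrow> y \<in> extensional {..<n} \<and> (\<forall>i<n. y i \<in> {a i ..< a i + l})"
    unfolding half_open_cube_def by (auto simp: PiE_iff)
  ultimately show ?thesis using bounds by blast
qed

lemma dyadic_cell_close:
  assumes x: "x \<in> half_open_cube n a l" and y: "y \<in> dyadic_cell n a l j x" and "i < n"
  shows "\<bar>y i - x i\<bar> < l / 2 ^ j"
proof -
  have "y i \<in> {cell_corner a l j x i ..< cell_corner a l j x i + l / 2 ^ j}"
    "x i \<in> {cell_corner a l j x i ..< cell_corner a l j x i + l / 2 ^ j}"
    using mem_cell_coordinate[OF x \<open>i < n\<close>] y \<open>i < n\<close> unfolding mem_dyadic_cell[OF x] by blast+
  then show ?thesis by auto
qed

text \<open>Here U is open in the full function space. Coordinates from n on are frozen at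
  \<open>undefined\<close>; the finitely many others are handled by one level j, as side lengths
  tend to 0.\<close>

lemma dyadic_cell_subset_open:
  assumes U: "open U" "x \<in> U" and x: "x \<in> half_open_cube n a l"
  shows "\<exists>j. dyadic_cell n a l j x \<subseteq> U"
proof -
  obtain X where X: "x \<in> PiE UNIV X" "\<And>i. open (X i)" "PiE UNIV X \<subseteq> U"
    using product_topology_open_contains_basis[of "\<lambda>_. euclideanreal" UNIV U x] U
    by (auto simp: euclidean_product_topology open_openin[symmetric])
  have "\<forall>i\<in>{..<n}. \<forall>\<^sub>F j in sequentially. \<forall>y. \<bar>y - x i\<bar> < l / 2 ^ j \<longrightarrow> y \<in> X i"
  proof
    fix i
    have "x i \<in> X i" using X(1) by auto
    then obtain e where e: "e > 0" "ball (x i) e \<subseteq> X i"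
      using X(2) open_contains_ball by blast
    have "(\<lambda>j. l / 2 ^ j) \<longlonglongrightarrow> 0"
      by (intro LIMSEQ_divide_realpow_zero) auto
    then have "\<forall>\<^sub>F j in sequentially. l / 2 ^ j < e"
      using e(1) by (rule order_tendstoD)
    then show "\<forall>\<^sub>F j in sequentially. \<forall>y. \<bar>y - x i\<bar> < l / 2 ^ j \<longrightarrow> y \<in> X i"
    proof eventually_elim
      case (elim j)
      then show ?case using e(2) by (auto simp: subset_eq dist_real_def abs_minus_commute)
    qed
  qed
  then have "\<forall>\<^sub>F j in sequentially. \<forall>i\<in>{..<n}. \<forall>y. \<bar>y - x i\<bar> < l / 2 ^ j \<longrightarrow> y \<in> X i"
    by (intro eventually_ball_finite) auto
  then have "\<exists>j. \<forall>i\<in>{..<n}. \<forall>y. \<bar>y - x i\<bar> < l / 2 ^ j \<longrightarrow> y \<in> X i"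
    by (rule eventually_happens'[rotated]) simp
  then obtain j where j: "\<And>i y. i < n \<Longrightarrow> \<bar>y - x i\<bar> < l / 2 ^ j \<Longrightarrow> y \<in> X i"
    unfolding Ball_def lessThan_iff by blast
  have "dyadic_cell n a l j x \<subseteq> U"
  proof
    fix y assume y: "y \<in> dyadic_cell n a l j x"
    have "y i \<in> X i" for i
    proof (cases "i < n")
      case True
      then show ?thesis using j dyadic_cell_close[OF x y] by blast
    next
      case False
      have "y i = undefined" "x i = undefined"
        using False x y unfolding dyadic_cell_def half_open_cube_def by (auto simp: PiE_iff extensional_def)
      then show ?thesis using X(1) by (metis PiE_mem UNIV_I)
    qed
    then show "y \<in> U" using X(3) by blast
  qed
  then show ?thesis by blast
qed

text \<open>Outer regularity is applied to a finite Borel measure on the full function space, so the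
  completed product measure has to be transported there.\<close>

lemma outer_approximation:
  assumes A: "A \<in> sets (leb n)" "A \<subseteq> half_open_cube n a l" and e: "0 < e"
  shows "\<exists>U. open U \<and> A \<subseteq> U \<and> U \<inter> half_open_cube n a l \<in> sets (leb n) \<and>
    emeasure (leb n) (U \<inter> half_open_cube n a l) \<le> emeasure (leb n) A + ennreal e"
proof -
  define \<mu> :: "(nat \<Rightarrow> real) measure" where "\<mu> = PiM {..<n} (\<lambda>_. lborel)"
  define \<Omega> where "\<Omega> = half_open_cube n a l"
  have \<Omega>[measurable]: "\<Omega> \<in> sets \<mu>"
    unfolding \<Omega>_def \<mu>_def by (rule half_open_cube_sets) (use l in simp)
  have leb: "leb n = completion \<mu>" by (simp add: leb_def \<mu>_def)
  obtain A' where A': "A' \<in> sets \<mu>" "A \<subseteq> A'" "emeasure (leb n) A = emeasure \<mu> A'"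
  proof -
    have "A \<in> sets (completion \<mu>)" using A(1) by (simp only: leb)
    then obtain A' where "A \<subseteq> A'" "A' \<in> sets \<mu>" "emeasure (completion \<mu>) A = emeasure \<mu> A'"
      by (rule completion_upper)
    then show ?thesis by (intro that) (simp_all only: leb)
  qed
  \<comment> \<open>The push-forward of the measure on the half-open cube under inclusion;
    finiteness of the volume makes it outer regular.\<close>
  define \<nu> where "\<nu> = distr (restrict_space \<mu> \<Omega>) borel (\<lambda>x. x)"
  have coord: "(\<lambda>x. x i) \<in> borel_measurable \<mu>" for i
  proof (cases "i < n")
    case True
    then show ?thesis
      using measurable_component_singleton[of i "{..<n}" "\<lambda>_. lborel :: real measure"]
      by (simp add: \<mu>_def)
  next
    case False
    then have "x i = undefined" if "x \<in> space \<mu>" for x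
      using that by (auto simp: \<mu>_def space_PiM PiE_iff extensional_def)
    then show ?thesis
      by (subst measurable_cong[where g = "\<lambda>_. undefined"]) auto
  qed
  have id: "(\<lambda>x. x) \<in> borel_measurable (restrict_space \<mu> \<Omega>)"
    using coord by (intro measurable_coordinatewise_then_product measurable_restrict_space1)
  have em: "emeasure \<nu> V = emeasure \<mu> (V \<inter> \<Omega>)" "V \<inter> \<Omega> \<in> sets \<mu>" if "V \<in> sets borel" for V
  proof -
    have sp: "space (restrict_space \<mu> \<Omega>) = \<Omega>"
      using sets.sets_into_space[OF \<Omega>] by (auto simp: space_restrict_space)
    have "(\<lambda>x. x) -` V \<inter> space (restrict_space \<mu> \<Omega>) \<in> sets (restrict_space \<mu> \<Omega>)"
      using id that by (rule measurable_sets)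
    then show "V \<inter> \<Omega> \<in> sets \<mu>"
      unfolding sp by (simp add: sets_restrict_space_iff)
    show "emeasure \<nu> V = emeasure \<mu> (V \<inter> \<Omega>)"
      unfolding \<nu>_def using id that
      by (subst emeasure_distr) (auto simp: sp intro!: emeasure_restrict_space)
  qed
  have fin: "emeasure \<mu> \<Omega> = ennreal (l ^ n)"
    using emeasure_half_open_cube[of l n a] l \<Omega> unfolding leb \<Omega>_def[symmetric] by simp
  \<comment> \<open>The cylinder over the measurable hull \<open>A'\<close>: it is Borel in the full
    space and has the same trace on \<open>\<Omega>\<close>.\<close>
  define A'' where "A'' = (\<lambda>y. restrict y {..<n}) -` A' \<inter> space borel"
  have "(\<lambda>y::nat \<Rightarrow> real. restrict y {..<n}) \<in> borel \<rightarrow>\<^sub>M \<mu>"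
    unfolding \<mu>_def by (intro measurable_restrict) (simp add: measurable_product_coordinates)
  then have A'': "A'' \<in> sets borel"
    unfolding A''_def using A'(1) by (rule measurable_sets)
  have ext: "restrict y {..<n} = y" if "y \<in> \<Omega>" for y
    using that by (simp add: \<Omega>_def half_open_cube_def PiE_iff extensional_restrict)
  have le: "emeasure \<nu> A'' \<le> emeasure (leb n) A"
    unfolding em(1)[OF A''] A'(3) using A'(1) em(2)[OF A'']
    by (intro emeasure_mono) (auto simp: A''_def ext)
  have "emeasure \<nu> A'' \<le> emeasure \<mu> \<Omega>"
    unfolding em(1)[OF A''] by (intro emeasure_mono) auto
  then have "emeasure \<nu> A'' < \<infinity>"
    using fin by (simp add: le_less_trans)
  then have lt: "emeasure \<nu> A'' < emeasure \<nu> A'' + ennreal e"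
    using e by (cases "emeasure \<nu> A''") (auto simp: ennreal_plus[symmetric] ennreal_less_iff simp del: ennreal_plus)
  have "emeasure \<nu> A'' = (INF U \<in> {U. A'' \<subseteq> U \<and> open U}. emeasure \<nu> U)"
  proof (rule outer_regular)
    have "emeasure \<nu> (space \<nu>) = emeasure \<mu> \<Omega>"
      using em(1)[of UNIV] by (simp add: \<nu>_def)
    then show "emeasure \<nu> (space \<nu>) \<noteq> \<infinity>" using fin by simp
  qed (use A'' in \<open>simp_all add: \<nu>_def\<close>)
  then obtain U where U: "A'' \<subseteq> U" "open U" "emeasure \<nu> U < emeasure \<nu> A'' + ennreal e"
    using lt by (auto simp: INF_less_iff)
  have "U \<in> sets borel" using U(2) by simp
  note emU = em[OF this]
  have "A \<subseteq> U"
    using A(2) A'(2) U(1) ext by (force simp: A''_def \<Omega>_def)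
  moreover have "emeasure \<mu> (U \<inter> \<Omega>) \<le> emeasure (leb n) A + ennreal e"
    using U(3) le unfolding emU(1) by (meson add_right_mono less_imp_le order_trans)
  moreover have "emeasure (leb n) (U \<inter> \<Omega>) = emeasure \<mu> (U \<inter> \<Omega>)" "U \<inter> \<Omega> \<in> sets (leb n)"
    using emU(2) by (simp_all add: leb)
  ultimately show ?thesis
    using U(2) unfolding \<Omega>_def by auto
qed

end

section \<open>Volumes, null boundaries and the dyadic filtration\<close>

lemma leb_finite: "A \<subseteq> half_open_cube n a l \<Longrightarrow> 0 \<le> l \<Longrightarrow> emeasure (leb n) A < \<infinity>"
  using emeasure_mono[of A "half_open_cube n a l" "leb n"]
    emeasure_half_open_cube[of l n a] leb_setsI[OF half_open_cube_sets, of l n a]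
  by (simp add: le_less_trans)

lemma emeasure_leb_eq:
  "A \<subseteq> half_open_cube n a l \<Longrightarrow> 0 \<le> l \<Longrightarrow> emeasure (leb n) A = ennreal (measure (leb n) A)"
  using leb_finite[of A n a l] by (intro emeasure_eq_ennreal_measure) auto

lemma measure_half_open_cube: "0 \<le> l \<Longrightarrow> measure (leb n) (half_open_cube n a l) = l ^ n"
  by (simp add: measure_def emeasure_half_open_cube)

lemma cube_minus_half_open_null:
  assumes "0 \<le> l" shows "cube n a l - half_open_cube n a l \<in> null_sets (leb n)"
proof (rule null_setsI)
  have s: "cube n a l \<in> sets (leb n)" "half_open_cube n a l \<in> sets (leb n)"
    using assms by (simp_all add: leb_setsI cube_sets half_open_cube_sets)
  then show "cube n a l - half_open_cube n a l \<in> sets (leb n)" by simp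
  show "emeasure (leb n) (cube n a l - half_open_cube n a l) = 0"
    using s assms half_open_cube_subset
    by (subst emeasure_Diff) (simp_all add: emeasure_cube emeasure_half_open_cube)
qed

text \<open>The index of a cell at one level determines that of its parent, which gives the nesting
  of consecutive levels.\<close>

lemma floor_double_div: "\<lfloor>u\<rfloor> = \<lfloor>2 * u\<rfloor> div 2" for u :: real
proof -
  have "2 * \<lfloor>u\<rfloor> \<le> \<lfloor>2 * u\<rfloor>" "\<lfloor>2 * u\<rfloor> \<le> 2 * \<lfloor>u\<rfloor> + 1" by linarith+
  then show ?thesis by presburger
qed

context
  fixes n :: nat and a :: "nat \<Rightarrow> real" and l :: real
  assumes l: "0 < l"
begin

lemma dyadic_cell_sets: "dyadic_cell n a l j x \<in> sets (leb n)"
  unfolding dyadic_cell_def using l by (intro leb_setsI half_open_cube_sets) simp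

lemma measure_dyadic_cell: "measure (leb n) (dyadic_cell n a l j x) = (l / 2 ^ j) ^ n"
  unfolding dyadic_cell_def using l by (intro measure_half_open_cube) simp

lemma dyadic_cell_subset:
  "x \<in> half_open_cube n a l \<Longrightarrow> dyadic_cell n a l j x \<subseteq> half_open_cube n a l"
  using mem_dyadic_cell[OF l] by blast

lemma space_restrict_half_open: "space (restrict_space (leb n) (half_open_cube n a l)) = half_open_cube n a l"
  using sets.sets_into_space[OF leb_setsI[OF half_open_cube_sets, of l n a]] l
  by (auto simp: space_restrict_space)

lemma sets_restrict_half_open:
  "A \<in> sets (restrict_space (leb n) (half_open_cube n a l)) \<longleftrightarrow> A \<in> sets (leb n) \<and> A \<subseteq> half_open_cube n a l"
proof -
  have "half_open_cube n a l \<inter> space (leb n) \<in> sets (leb n)"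
    using leb_setsI[OF half_open_cube_sets, of l n a] l by simp
  then show ?thesis by (simp add: sets_restrict_space_iff conj_commute)
qed

lemma measure_restrict_half_open:
  assumes "A \<subseteq> half_open_cube n a l"
  shows "measure (restrict_space (leb n) (half_open_cube n a l)) A = measure (leb n) A"
  using assms leb_setsI[OF half_open_cube_sets, of l n a] l by (intro measure_restrict_space) auto

lemma cell_filtration_dyadic_cell:
  "cell_filtration (restrict_space (leb n) (half_open_cube n a l)) (dyadic_cell n a l) (2 ^ n)"
proof -
  define \<Omega> where "\<Omega> = half_open_cube n a l"
  define M where "M = restrict_space (leb n) \<Omega>"
  note mem = mem_dyadic_cell[OF l, where n = n and a = a, folded \<Omega>_def]
  note sub = dyadic_cell_subset[folded \<Omega>_def]
  have sp: "space M = \<Omega>" using space_restrict_half_open by (simp add: M_def \<Omega>_def)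
  have sets: "A \<in> sets M \<longleftrightarrow> A \<in> sets (leb n) \<and> A \<subseteq> \<Omega>" for A
    using sets_restrict_half_open by (simp add: M_def \<Omega>_def)
  have meas: "measure M A = measure (leb n) A" if "A \<subseteq> \<Omega>" for A
    using measure_restrict_half_open that by (simp add: M_def \<Omega>_def)
  have \<Omega>s: "\<Omega> \<in> sets (leb n)"
    unfolding \<Omega>_def using l by (intro leb_setsI half_open_cube_sets) simp
  have "cell_filtration M (dyadic_cell n a l) (2 ^ n)"
  proof (intro cell_filtration.intro cell_filtration_axioms.intro finite_measureI)
    show "emeasure M (space M) \<noteq> \<infinity>"
      using leb_finite[of \<Omega> n a l] l \<Omega>s unfolding sp M_def
      by (subst emeasure_restrict_space) (auto simp: \<Omega>_def)
  next
    fix x j assume x: "x \<in> space M"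
    then have x': "x \<in> \<Omega>" by (simp add: sp)
    show "dyadic_cell n a l j x \<in> sets M"
      using dyadic_cell_sets sub[OF x'] by (simp add: sets)
    show "x \<in> dyadic_cell n a l j x"
      using x' by (simp add: mem)
    show "dyadic_cell n a l 0 x = space M"
    proof -
      have "\<lfloor>(y i - a i) * 2 ^ 0 / l\<rfloor> = 0" if "y \<in> \<Omega>" "i < n" for y i
        using scaled_bounds[OF l, of y n a i 0] that unfolding \<Omega>_def by (simp add: floor_eq_iff)
      then show ?thesis using x' unfolding sp set_eq_iff mem[OF x'] by auto
    qed
    show "dyadic_cell n a l (Suc j) x \<subseteq> dyadic_cell n a l j x"
    proof
      fix y assume y: "y \<in> dyadic_cell n a l (Suc j) x"
      have eq: "(z - a i) * 2 ^ Suc j / l = 2 * ((z - a i) * 2 ^ j / l)" for z i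
        by simp
      have "\<lfloor>(y i - a i) * 2 ^ j / l\<rfloor> = \<lfloor>(x i - a i) * 2 ^ j / l\<rfloor>" if "i < n" for i
        using y that unfolding mem[OF x'] eq by (metis floor_double_div)
      then show "y \<in> dyadic_cell n a l j x"
        using y by (simp add: mem[OF x'])
    qed
    show "0 < measure M (dyadic_cell n a l j x)"
      using l by (simp add: meas[OF sub[OF x']] measure_dyadic_cell)
    show "measure M (dyadic_cell n a l j x) \<le> 2 ^ n * measure M (dyadic_cell n a l (Suc j) x)"
    proof -
      have "(l / 2 ^ j) ^ n = 2 ^ n * (l / 2 ^ Suc j) ^ n"
        unfolding power_mult_distrib[symmetric] by simp
      then show ?thesis by (simp add: meas[OF sub[OF x']] measure_dyadic_cell)
    qed
    fix y assume y: "y \<in> dyadic_cell n a l j x"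
    then have "y \<in> \<Omega>" using sub[OF x'] by blast
    then show "dyadic_cell n a l j y = dyadic_cell n a l j x"
      using y unfolding set_eq_iff mem[OF x'] mem[OF \<open>y \<in> \<Omega>\<close>] by auto
  next
    fix j
    have "dyadic_cell n a l j ` space M \<subseteq>
      (\<lambda>k. half_open_cube n (\<lambda>i. a i + real (k i) * (l / 2 ^ j)) (l / 2 ^ j)) ` (PiE {..<n} (\<lambda>_. UNIV :: nat set))"
    proof
      fix C assume "C \<in> dyadic_cell n a l j ` space M"
      then obtain x where "C = dyadic_cell n a l j x" by blast
      then have "C = half_open_cube n (\<lambda>i. a i + real (restrict (cell_index a l j x) {..<n} i) * (l / 2 ^ j)) (l / 2 ^ j)"
        unfolding dyadic_cell_def half_open_cube_def cell_corner_def by (auto intro!: PiE_cong)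
      moreover have "restrict (cell_index a l j x) {..<n} \<in> PiE {..<n} (\<lambda>_. UNIV :: nat set)"
        by simp
      ultimately show "C \<in> (\<lambda>k. half_open_cube n (\<lambda>i. a i + real (k i) * (l / 2 ^ j)) (l / 2 ^ j)) ` (PiE {..<n} (\<lambda>_. UNIV :: nat set))"
        by blast
    qed
    moreover have "countable (PiE {..<n} (\<lambda>_. UNIV :: nat set))"
      by (intro countable_PiE) auto
    ultimately show "countable (dyadic_cell n a l j ` space M)"
      by (meson countable_image countable_subset)
  next
    fix A and e :: real assume A: "A \<in> sets M" and e: "0 < e"
    then obtain U where U: "open U" "A \<subseteq> U" "U \<inter> \<Omega> \<in> sets (leb n)"
      "emeasure (leb n) (U \<inter> \<Omega>) \<le> emeasure (leb n) A + ennreal e"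
      using outer_approximation[OF l, of A n a e] unfolding sets \<Omega>_def by blast
    \<comment> \<open>The cells to select are those contained in U. Their union lies between A and
      the part of U in the cube.\<close>
    define E where "E = {x \<in> space M. \<exists>j. dyadic_cell n a l j x \<subseteq> U}"
    have "A \<subseteq> E"
    proof
      fix x assume "x \<in> A"
      then have x: "x \<in> \<Omega>" "x \<in> U" using A U(2) by (auto simp: sets)
      then show "x \<in> E"
        using dyadic_cell_subset_open[OF l U(1) x(2)] by (auto simp: E_def sp \<Omega>_def)
    qed
    moreover have "measure M E \<le> measure M A + e"
    proof -
      have AO: "A \<subseteq> \<Omega>" using A by (simp add: sets)
      have EO: "E \<subseteq> U \<inter> \<Omega>"
      proof
        fix x assume x: "x \<in> E"
        then obtain j where j: "dyadic_cell n a l j x \<subseteq> U" "x \<in> \<Omega>" by (auto simp: E_def sp)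
        have "x \<in> dyadic_cell n a l j x" using j(2) by (simp add: mem)
        then show "x \<in> U \<inter> \<Omega>" using j by blast
      qed
      have "emeasure (leb n) E \<le> emeasure (leb n) (U \<inter> \<Omega>)"
        using EO U(3) by (rule emeasure_mono)
      also note U(4)
      finally have "emeasure (leb n) E \<le> emeasure (leb n) A + ennreal e" .
      moreover have "emeasure (leb n) E = ennreal (measure M E)"
        using EO l meas[of E] emeasure_leb_eq[of E n a l] by (simp add: \<Omega>_def)
      moreover have "emeasure (leb n) A = ennreal (measure M A)"
        using AO l meas[of A] emeasure_leb_eq[of A n a l] by (simp add: \<Omega>_def)
      ultimately show ?thesis
        using e by (simp add: ennreal_plus[symmetric] del: ennreal_plus)
    qed
    ultimately show "\<exists>S. A \<subseteq> {x \<in> space M. \<exists>j. S (dyadic_cell n a l j x)} \<and>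
        measure M {x \<in> space M. \<exists>j. S (dyadic_cell n a l j x)} \<le> measure M A + e"
      unfolding E_def by (intro exI[of _ "\<lambda>C. C \<subseteq> U"] conjI)
  qed
  then show ?thesis by (simp add: M_def \<Omega>_def)
qed

end

section \<open>Medians and the John-Nirenberg norm\<close>

text \<open>A level below d has a larger superlevel set, so it fails the strict inequality in the
  definition of the median; equality at d therefore suffices.\<close>

lemma maximal_median_ge:
  assumes Q: "{x \<in> Q. g x > ereal d} \<in> sets (leb n)"
    and meas: "\<And>b. {x \<in> Q. g x > ereal b} \<in> sets (leb n)"
    and le: "ennreal s * emeasure (leb n) Q \<le> emeasure (leb n) {x \<in> Q. g x > ereal d}"
  shows "ereal d \<le> maximal_median n s g Q"
  unfolding maximal_median_def
proof (rule Inf_greatest, clarify)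
  fix b assume b: "emeasure (leb n) {x \<in> Q. g x > ereal b} < ennreal s * emeasure (leb n) Q"
  have "d \<le> b"
  proof (rule ccontr)
    assume "\<not> d \<le> b"
    then have "{x \<in> Q. g x > ereal d} \<subseteq> {x \<in> Q. g x > ereal b}"
      by (auto intro: less_trans[of "ereal b" "ereal d"])
    then have "emeasure (leb n) {x \<in> Q. g x > ereal d} \<le> emeasure (leb n) {x \<in> Q. g x > ereal b}"
      using meas by (rule emeasure_mono)
    then show False using b le by simp
  qed
  then show "ereal d \<le> ereal b" by simp
qed

lemma epowr_ge:
  assumes "ereal d \<le> v" "0 < d" "0 < q"
  shows "ennreal (d powr q) \<le> epowr (e2ennreal v) q"
proof (cases v)
  case (real b)
  then show ?thesis
    using assms by (auto simp: epowr_def e2ennreal_ereal powr_mono2 intro!: ennreal_leI)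
next
  case PInf
  then show ?thesis by (simp add: epowr_def)
next
  case MInf
  then show ?thesis using assms by simp
qed

lemma epowr_JN_norm:
  assumes "0 < p" "JN_norm n p s Q0 f < \<infinity>"
  shows "JN_sup n p s Q0 f < \<infinity>" "epowr (JN_norm n p s Q0 f) p = JN_sup n p s Q0 f"
proof -
  show fin: "JN_sup n p s Q0 f < \<infinity>"
    using assms by (auto simp: JN_norm_def epowr_def less_top split: if_splits)
  then show "epowr (JN_norm n p s Q0 f) p = JN_sup n p s Q0 f"
    using assms by (auto simp: JN_norm_def epowr_def powr_powr less_top)
qed

section \<open>Closed dyadic cubes against half-open cells\<close>

context
  fixes n :: nat and a :: "nat \<Rightarrow> real" and l :: real and f :: "(nat \<Rightarrow> real) \<Rightarrow> ereal"
  assumes l: "0 < l" and f: "f \<in> borel_measurable (restrict_space (leb n) (cube n a l))"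
begin

lemma cube_in_sets: "cube n a l \<in> sets (leb n)"
  using l by (intro leb_setsI cube_sets) simp

lemma superlevel_subset_sets:
  assumes Q: "Q \<in> sets (leb n)" "Q \<subseteq> cube n a l"
  shows "{x \<in> Q. f x > ereal b} \<in> sets (leb n)" "{x \<in> Q. \<bar>f x - ereal c\<bar> > ereal b} \<in> sets (leb n)"
proof -
  have sp: "space (restrict_space (leb n) (cube n a l)) = cube n a l"
    using sets.sets_into_space[OF cube_in_sets] by (auto simp: space_restrict_space)
  have *: "{x \<in> Q. R x} \<in> sets (leb n)" if "{x \<in> space (restrict_space (leb n) (cube n a l)). R x} \<in> sets (restrict_space (leb n) (cube n a l))" for R
  proof -
    have "{x \<in> cube n a l. R x} \<in> sets (leb n)"
      using that cube_in_sets unfolding sp by (simp add: sets_restrict_space_iff)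
    then have "Q \<inter> {x \<in> cube n a l. R x} \<in> sets (leb n)" using Q(1) by simp
    moreover have "Q \<inter> {x \<in> cube n a l. R x} = {x \<in> Q. R x}" using Q(2) by blast
    ultimately show ?thesis by simp
  qed
  note [measurable] = f
  show "{x \<in> Q. f x > ereal b} \<in> sets (leb n)" by (rule *) measurable
  show "{x \<in> Q. \<bar>f x - ereal c\<bar> > ereal b} \<in> sets (leb n)" by (rule *) measurable
qed

text \<open>The closed cube with the same corner and side is a dyadic subcube in the sense of the
  norm, and the cell lies between its interior and itself with equal volume.\<close>

lemma closed_cell:
  fixes j :: nat
  assumes x: "x \<in> half_open_cube n a l"
  defines "Q \<equiv> cube n (cell_corner a l j x) (l / 2 ^ j)"
  shows "Q \<in> dyadic_subcubes n (cube n a l)" "dyadic_cell n a l j x \<subseteq> Q"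
    "cube_interior n Q \<subseteq> dyadic_cell n a l j x" "Q \<subseteq> cube n a l" "Q \<in> sets (leb n)"
    "emeasure (leb n) Q = emeasure (leb n) (dyadic_cell n a l j x)"
proof -
  have "Q \<in> dyadic_level n j (cube n a l)"
    unfolding dyadic_level_def Q_def cell_corner_def using l cell_index_less[OF l x, of _ j] by blast
  then show "Q \<in> dyadic_subcubes n (cube n a l)" by (auto simp: dyadic_subcubes_def)
  show "dyadic_cell n a l j x \<subseteq> Q"
    unfolding Q_def dyadic_cell_def by (rule half_open_cube_subset)
  show "cube_interior n Q \<subseteq> dyadic_cell n a l j x"
    unfolding Q_def dyadic_cell_def by (rule cube_interior_subset)
  have pos: "0 \<le> l / 2 ^ j" using l by simp
  show "Q \<in> sets (leb n)" unfolding Q_def using pos by (intro leb_setsI cube_sets)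
  show "emeasure (leb n) Q = emeasure (leb n) (dyadic_cell n a l j x)"
    unfolding Q_def dyadic_cell_def using pos by (simp add: emeasure_cube emeasure_half_open_cube)
  show "Q \<subseteq> cube n a l"
    unfolding Q_def cube_def
  proof (rule PiE_mono)
    fix i assume i: "i \<in> {..<n}"
    define k where "k = cell_index a l j x i"
    have "real (k + 1) \<le> real (2 ^ j)"
      using cell_index_less[OF l x, of i j] i unfolding of_nat_le_iff k_def by simp
    then have "real (k + 1) * (l / 2 ^ j) \<le> 2 ^ j * (l / 2 ^ j)"
      using pos by (intro mult_right_mono) auto
    moreover have "2 ^ j * (l / 2 ^ j) = l" by simp
    ultimately have "real k * (l / 2 ^ j) + l / 2 ^ j \<le> l" by (simp only: of_nat_add of_nat_1 distrib_right mult_1_left)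
    moreover have "0 \<le> real k * (l / 2 ^ j)" by (intro mult_nonneg_nonneg pos) simp
    ultimately show "{cell_corner a l j x i..cell_corner a l j x i + l / 2 ^ j} \<subseteq> {a i..a i + l}"
      unfolding cell_corner_def k_def[symmetric] by auto
  qed
qed

text \<open>Closing the cells gives an admissible collection for the supremum. On each closed cube
  all the medians are at least d, so its summand is at least \<open>d powr p\<close> times its
  volume.\<close>

lemma JN_sup_ge:
  assumes F: "finite F" "F \<subseteq> (\<Union>j. dyadic_cell n a l j ` half_open_cube n a l)" "disjoint F"
    and d: "0 < d" and s: "0 \<le> s" and p: "0 < p"
    and bad: "\<And>C c. C \<in> F \<Longrightarrow> s * measure (leb n) C \<le> measure (leb n) {x \<in> C. \<bar>f x - ereal c\<bar> > ereal d}"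
  shows "ennreal ((\<Sum>C\<in>F. measure (leb n) C) * d powr p) \<le> JN_sup n p s (cube n a l) f"
proof -
  have "\<forall>C\<in>F. \<exists>Q. \<exists>j x. x \<in> half_open_cube n a l \<and> C = dyadic_cell n a l j x \<and>
      Q = cube n (cell_corner a l j x) (l / 2 ^ j)"
    using F(2) by blast
  then obtain q where q: "\<forall>C\<in>F. \<exists>j x. x \<in> half_open_cube n a l \<and> C = dyadic_cell n a l j x \<and>
      q C = cube n (cell_corner a l j x) (l / 2 ^ j)"
    by (rule bchoice[THEN exE])
  have q_props: "q C \<in> dyadic_subcubes n (cube n a l)" "C \<subseteq> q C" "cube_interior n (q C) \<subseteq> C"
      "q C \<subseteq> cube n a l" "q C \<in> sets (leb n)" "emeasure (leb n) (q C) = ennreal (measure (leb n) C)"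
      "C \<in> sets (leb n)" "C \<subseteq> half_open_cube n a l" "0 < measure (leb n) C"
    if CF: "C \<in> F" for C
  proof -
    obtain j x where x: "x \<in> half_open_cube n a l" and C: "C = dyadic_cell n a l j x"
      and qC: "q C = cube n (cell_corner a l j x) (l / 2 ^ j)"
      using bspec[OF q CF] by blast
    note cl = closed_cell[OF x, of j, folded qC, folded C]
    show "q C \<in> dyadic_subcubes n (cube n a l)" "C \<subseteq> q C" "cube_interior n (q C) \<subseteq> C"
      "q C \<subseteq> cube n a l" "q C \<in> sets (leb n)"
      using cl by blast+
    show "C \<in> sets (leb n)" unfolding C by (rule dyadic_cell_sets[OF l])
    show sub: "C \<subseteq> half_open_cube n a l" unfolding C by (rule dyadic_cell_subset[OF l x])
    show "0 < measure (leb n) C" unfolding C using l by (simp add: measure_dyadic_cell)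
    show "emeasure (leb n) (q C) = ennreal (measure (leb n) C)"
      using emeasure_leb_eq[OF sub] l cl(6) by simp
  qed
  \<comment> \<open>Two distinct cells with the same closed cube would be disjoint and each have its
    full positive volume. Injectivity turns the sum over cubes into a sum over cells.\<close>
  have inj: "inj_on q F"
  proof (rule inj_onI, rule ccontr)
    fix C D assume CD: "C \<in> F" "D \<in> F" "q C = q D" "C \<noteq> D"
    have disj: "C \<inter> D = {}" using F(3) CD by (auto dest: disjointD)
    note C = q_props[OF CD(1)] and D = q_props[OF CD(2)]
    have "emeasure (leb n) C + emeasure (leb n) D = emeasure (leb n) (C \<union> D)"
      using C(7) D(7) disj by (rule plus_emeasure)
    also have "\<dots> \<le> emeasure (leb n) (q C)"
      using C(2) D(2) CD(3) by (intro emeasure_mono C(5)) auto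
    finally have "ennreal (measure (leb n) C) + ennreal (measure (leb n) D) \<le> ennreal (measure (leb n) C)"
      using C(6,8) D(8) l by (simp add: emeasure_leb_eq)
    then show False
      using C(9) D(9) by (simp add: ennreal_plus[symmetric] del: ennreal_plus)
  qed
  define h where "h Q = emeasure (leb n) Q *
    epowr (e2ennreal (INF c::real. maximal_median n s (\<lambda>x. \<bar>f x - ereal c\<bar>) Q)) p" for Q
  have summand: "ennreal (measure (leb n) C * d powr p) \<le> h (q C)" if C: "C \<in> F" for C
  proof -
    note C' = q_props[OF C]
    have "ereal d \<le> maximal_median n s (\<lambda>x. \<bar>f x - ereal c\<bar>) (q C)" for c
    proof (rule maximal_median_ge)
      have "ennreal s * emeasure (leb n) (q C) = ennreal (s * measure (leb n) C)"
        using s C'(6) by (simp add: ennreal_mult)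
      also have "\<dots> \<le> ennreal (measure (leb n) {x \<in> C. \<bar>f x - ereal c\<bar> > ereal d})"
        using bad[OF C] by (rule ennreal_leI)
      also have "\<dots> = emeasure (leb n) {x \<in> C. \<bar>f x - ereal c\<bar> > ereal d}"
        using C'(8) l by (intro emeasure_leb_eq[symmetric]) auto
      also have "\<dots> \<le> emeasure (leb n) {x \<in> q C. \<bar>f x - ereal c\<bar> > ereal d}"
        using C'(2) superlevel_subset_sets[OF C'(5,4)] by (intro emeasure_mono) auto
      finally show "ennreal s * emeasure (leb n) (q C) \<le> emeasure (leb n) {x \<in> q C. \<bar>f x - ereal c\<bar> > ereal d}" .
    qed (rule superlevel_subset_sets[OF C'(5,4)])+
    then have "ereal d \<le> (INF c::real. maximal_median n s (\<lambda>x. \<bar>f x - ereal c\<bar>) (q C))"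
      by (rule INF_greatest)
    then have "ennreal (d powr p) \<le> epowr (e2ennreal (INF c::real. maximal_median n s (\<lambda>x. \<bar>f x - ereal c\<bar>) (q C))) p"
      using d p by (rule epowr_ge)
    then show ?thesis
      unfolding h_def C'(6) by (simp add: ennreal_mult mult_left_mono)
  qed
  have "ennreal ((\<Sum>C\<in>F. measure (leb n) C) * d powr p) = (\<Sum>C\<in>F. ennreal (measure (leb n) C * d powr p))"
    by (simp add: sum_distrib_right)
  also have "\<dots> \<le> (\<Sum>C\<in>F. h (q C))"
    by (intro sum_mono summand)
  also have "\<dots> = (\<Sum>\<^sub>\<infinity>Q\<in>q ` F. h Q)"
    using F(1) inj by (simp add: sum.reindex)
  also have "\<dots> \<le> JN_sup n p s (cube n a l) f"
    unfolding JN_sup_def h_def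
  proof (rule SUP_upper, intro CollectI conjI)
    show "q ` F \<subseteq> dyadic_subcubes n (cube n a l)" using q_props(1) by blast
    show "countable (q ` F)" using F(1) by (simp add: countable_finite)
    show "pairwise (\<lambda>P Q. cube_interior n P \<inter> cube_interior n Q = {}) (q ` F)"
    proof (rule pairwiseI)
      fix P Q assume "P \<in> q ` F" "Q \<in> q ` F" "P \<noteq> Q"
      then obtain C D where CD: "C \<in> F" "D \<in> F" "P = q C" "Q = q D" "C \<noteq> D" by blast
      then have "C \<inter> D = {}" using F(3) by (auto dest: disjointD)
      then show "cube_interior n P \<inter> cube_interior n Q = {}"
        using q_props(3)[OF CD(1)] q_props(3)[OF CD(2)] CD(3,4) by blast
    qed
  qed
  finally show ?thesis .
qed

text \<open>Off a set of relative measure below s, f lies between c - d and c + d. From above, s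
  \<le> r suffices; from below, the remaining fraction exceeds 1 - s, which is at least 1/2 and
  hence at least r.\<close>

lemma median_close:
  assumes s: "0 < s" "s \<le> r" "r \<le> 1 / 2"
    and small: "measure (leb n) {x \<in> half_open_cube n a l. \<bar>f x - ereal c\<bar> > ereal d}
      < s * measure (leb n) (half_open_cube n a l)"
  shows "ereal (c - d) \<le> maximal_median n r f (cube n a l)"
    "maximal_median n r f (cube n a l) \<le> ereal (c + d)"
proof -
  define \<Omega> where "\<Omega> = half_open_cube n a l"
  define W where "W = measure (leb n) \<Omega>"
  define Z where "Z = {x \<in> \<Omega>. \<bar>f x - ereal c\<bar> > ereal d}"
  have \<Omega>: "\<Omega> \<in> sets (leb n)" "\<Omega> \<subseteq> cube n a l"
    unfolding \<Omega>_def using l by (auto intro!: leb_setsI half_open_cube_sets simp: half_open_cube_subset)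
  have Z: "Z \<in> sets (leb n)" unfolding Z_def by (rule superlevel_subset_sets[OF \<Omega>])
  have W: "0 < W" unfolding W_def \<Omega>_def using l by (simp add: measure_half_open_cube)
  have cW: "emeasure (leb n) (cube n a l) = ennreal W"
    unfolding W_def \<Omega>_def using l by (simp add: measure_half_open_cube emeasure_cube)
  have fin: "A \<subseteq> \<Omega> \<Longrightarrow> emeasure (leb n) A = ennreal (measure (leb n) A)" for A
    unfolding \<Omega>_def using l by (simp add: emeasure_leb_eq)
  have small': "measure (leb n) Z < s * W" using small by (simp add: Z_def W_def \<Omega>_def)
  have sets: "{x \<in> cube n a l. f x > ereal b} \<in> sets (leb n)" for b
    by (rule superlevel_subset_sets[OF cube_in_sets order_refl])
  have null: "cube n a l - \<Omega> \<in> null_sets (leb n)"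
    unfolding \<Omega>_def using l by (intro cube_minus_half_open_null) simp
  show "maximal_median n r f (cube n a l) \<le> ereal (c + d)"
    unfolding maximal_median_def
  proof (rule Inf_lower, rule imageI, rule CollectI)
    have "{x \<in> cube n a l. f x > ereal (c + d)} \<subseteq> Z \<union> (cube n a l - \<Omega>)"
    proof
      fix x assume x: "x \<in> {x \<in> cube n a l. f x > ereal (c + d)}"
      then have "\<bar>f x - ereal c\<bar> > ereal d" by (cases "f x") auto
      then show "x \<in> Z \<union> (cube n a l - \<Omega>)" using x by (auto simp: Z_def)
    qed
    then have "emeasure (leb n) {x \<in> cube n a l. f x > ereal (c + d)} \<le> emeasure (leb n) (Z \<union> (cube n a l - \<Omega>))"
      using Z null by (intro emeasure_mono) auto
    also have "\<dots> = emeasure (leb n) Z"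
      using Z null by (rule emeasure_Un_null_set)
    also have "\<dots> = ennreal (measure (leb n) Z)"
      by (rule fin) (auto simp: Z_def)
    also have "\<dots> < ennreal (r * W)"
    proof (rule ennreal_lessI)
      have "s * W \<le> r * W" using s W by (intro mult_right_mono) auto
      then show "measure (leb n) Z < r * W" using small' by linarith
      show "0 < r * W" using s W by simp
    qed
    also have "\<dots> = ennreal r * emeasure (leb n) (cube n a l)"
      using s W by (simp add: cW ennreal_mult)
    finally show "emeasure (leb n) {x \<in> cube n a l. f x > ereal (c + d)} < ennreal r * emeasure (leb n) (cube n a l)" .
  qed
  show "ereal (c - d) \<le> maximal_median n r f (cube n a l)"
    unfolding maximal_median_def
  proof (rule Inf_greatest, clarify)
    fix b assume b: "emeasure (leb n) {x \<in> cube n a l. f x > ereal b} < ennreal r * emeasure (leb n) (cube n a l)"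
    have "c - d \<le> b"
    proof (rule ccontr)
      assume "\<not> c - d \<le> b"
      then have bl: "b < c - d" by simp
      have "\<Omega> - Z \<subseteq> {x \<in> cube n a l. f x > ereal b}"
      proof
        fix x assume x: "x \<in> \<Omega> - Z"
        then have "\<bar>f x - ereal c\<bar> \<le> ereal d" by (auto simp: Z_def not_less)
        then have "f x > ereal b" using bl by (cases "f x") auto
        then show "x \<in> {x \<in> cube n a l. f x > ereal b}" using x \<Omega>(2) by auto
      qed
      then have "emeasure (leb n) (\<Omega> - Z) \<le> emeasure (leb n) {x \<in> cube n a l. f x > ereal b}"
        using sets by (rule emeasure_mono)
      also note b
      also have "ennreal r * emeasure (leb n) (cube n a l) = ennreal (r * W)"
        using s W by (simp add: cW ennreal_mult)
      finally have "measure (leb n) (\<Omega> - Z) < r * W"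
        using fin[of "\<Omega> - Z"] s W by (simp add: ennreal_less_iff)
      moreover have "measure (leb n) (\<Omega> - Z) = W - measure (leb n) Z"
        unfolding W_def using \<Omega>(1) Z fin[of \<Omega>] by (intro measure_Diff) (auto simp: Z_def)
      moreover have "s * W \<le> r * W" using s W by (intro mult_right_mono) auto
      moreover have "r * W \<le> 1 / 2 * W" using s W by (intro mult_right_mono) auto
      ultimately show False using small' by simp
    qed
    then show "ereal (c - d) \<le> ereal b" by simp
  qed
qed

lemma weak_type_median:
  assumes p: "1 < p" and s: "0 < s" "s \<le> 1 / 2 ^ (n + 3)" "s \<le> r" "r \<le> 1 / 2" and u: "0 < u"
    and fin: "JN_sup n p s (cube n a l) f < \<infinity>"
  defines "\<theta> \<equiv> (3 / 2) powr (1 / p)"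
  shows "emeasure (leb n) {x \<in> cube n a l. \<bar>f x - maximal_median n r f (cube n a l)\<bar> > ereal u}
    \<le> ennreal (4 * (2 * \<theta> / (\<theta> - 1)) powr p) * JN_sup n p s (cube n a l) f / ennreal (u powr p)"
proof -
  define \<Omega> where "\<Omega> = half_open_cube n a l"
  define M where "M = restrict_space (leb n) \<Omega>"
  define B where "B = enn2real (JN_sup n p s (cube n a l) f)"
  interpret cell_filtration M "dyadic_cell n a l" "2 ^ n"
    unfolding M_def \<Omega>_def by (rule cell_filtration_dyadic_cell[OF l])
  have JN: "JN_sup n p s (cube n a l) f = ennreal B" "0 \<le> B"
    using fin by (auto simp: B_def)
  have sp: "space M = \<Omega>" unfolding M_def \<Omega>_def by (rule space_restrict_half_open[OF l])
  have meas: "A \<subseteq> \<Omega> \<Longrightarrow> measure M A = measure (leb n) A" for A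
    unfolding M_def \<Omega>_def by (rule measure_restrict_half_open[OF l])
  have \<Omega>: "\<Omega> \<in> sets (leb n)" "\<Omega> \<subseteq> cube n a l"
    unfolding \<Omega>_def using l by (auto intro!: leb_setsI half_open_cube_sets simp: half_open_cube_subset)
  have bound: "(\<Sum>C\<in>F. measure M C) * d powr p \<le> B"
    if F: "finite F" "F \<subseteq> (\<Union>j. dyadic_cell n a l j ` space M)" "disjoint F" and d: "0 < d"
      and bad: "\<And>C c. C \<in> F \<Longrightarrow> s * measure M C \<le> measure M {x \<in> C. \<bar>f x - ereal c\<bar> > ereal d}"
    for F d
  proof -
    have sub: "C \<subseteq> \<Omega>" if "C \<in> F" for C
      using that F(2) cell_space unfolding sp by blast
    have "ennreal ((\<Sum>C\<in>F. measure (leb n) C) * d powr p) \<le> ennreal B"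
      unfolding JN(1)[symmetric]
    proof (rule JN_sup_ge[OF F(1) _ F(3) d])
      show "F \<subseteq> (\<Union>j. dyadic_cell n a l j ` half_open_cube n a l)" using F(2) by (simp add: sp \<Omega>_def)
      fix C c assume C: "C \<in> F"
      have "{x \<in> C. \<bar>f x - ereal c\<bar> > ereal d} \<subseteq> \<Omega>" using sub[OF C] by blast
      then show "s * measure (leb n) C \<le> measure (leb n) {x \<in> C. \<bar>f x - ereal c\<bar> > ereal d}"
        using bad[OF C, of c] by (simp add: meas sub[OF C])
    qed (use s p in auto)
    moreover have "(\<Sum>C\<in>F. measure M C) = (\<Sum>C\<in>F. measure (leb n) C)"
      by (intro sum.cong) (auto simp: meas sub)
    ultimately show ?thesis using JN(2) by simp
  qed
  define W where "W = measure M \<Omega>"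
  have "W = l ^ n"
    unfolding W_def using meas[of \<Omega>] measure_half_open_cube[of l n a] l by (simp add: \<Omega>_def)
  then have W: "0 < W" using l by simp
  obtain x0 where x0: "x0 \<in> \<Omega>"
    using W unfolding W_def by (metis all_not_in_conv measure_empty order_less_irrefl)
  \<comment> \<open>Needed for the median to be finite: otherwise the cube itself would be bad at
    every height, against the finite norm.\<close>
  have "\<exists>d>0. \<exists>c. measure M {x \<in> \<Omega>. \<bar>f x - ereal c\<bar> > ereal d} < s * W"
  proof (rule ccontr)
    assume neg: "\<not> (\<exists>d>0. \<exists>c. measure M {x \<in> \<Omega>. \<bar>f x - ereal c\<bar> > ereal d} < s * W)"
    \<comment> \<open>Chosen so that \<open>W * d powr p = B + W\<close>, which exceeds B.\<close>
    define d where "d = (B / W + 1) powr (1 / p)"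
    have "0 < B / W + 1" using JN(2) W by (intro add_nonneg_pos) auto
    then have d: "0 < d" "d powr p = B / W + 1"
      using p by (simp_all add: d_def powr_powr)
    have "(\<Sum>C\<in>{\<Omega>}. measure M C) * d powr p \<le> B"
    proof (rule bound)
      show "{\<Omega>} \<subseteq> (\<Union>j. dyadic_cell n a l j ` space M)"
        using cell_0[of x0] x0 unfolding sp by blast
      fix C c assume C: "C \<in> {\<Omega>}"
      have "\<not> measure M {x \<in> \<Omega>. \<bar>f x - ereal c\<bar> > ereal d} < s * W" using neg d(1) by blast
      then show "s * measure M C \<le> measure M {x \<in> C. \<bar>f x - ereal c\<bar> > ereal d}"
        using C by (simp add: W_def)
    qed (use d in auto)
    then have "W * (B / W + 1) \<le> B" by (simp add: W_def d)
    moreover have "W * (B / W + 1) = B + W" using W by (simp add: distrib_left)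
    ultimately show False using W by linarith
  qed
  then obtain d c where dc: "0 < d" "measure M {x \<in> \<Omega>. \<bar>f x - ereal c\<bar> > ereal d} < s * W" by blast
  have close: "ereal (c - d) \<le> maximal_median n r f (cube n a l)"
    "maximal_median n r f (cube n a l) \<le> ereal (c + d)"
    if "measure M {x \<in> \<Omega>. \<bar>f x - ereal c\<bar> > ereal d} < s * W" for c d
  proof -
    have "{x \<in> \<Omega>. \<bar>f x - ereal c\<bar> > ereal d} \<subseteq> \<Omega>" by blast
    then have "measure (leb n) {x \<in> half_open_cube n a l. \<bar>f x - ereal c\<bar> > ereal d} < s * measure (leb n) (half_open_cube n a l)"
      using that by (simp add: meas W_def \<Omega>_def[symmetric])
    from median_close[OF s(1,3,4) this]
    show "ereal (c - d) \<le> maximal_median n r f (cube n a l)"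
      "maximal_median n r f (cube n a l) \<le> ereal (c + d)" .
  qed
  obtain m where m: "maximal_median n r f (cube n a l) = ereal m"
    using close[OF dc(2)] by (cases "maximal_median n r f (cube n a l)") auto
  have fM: "f \<in> borel_measurable M"
    unfolding M_def using f \<Omega>(2) by (rule measurable_restrict_mono)
  interpret cell_oscillation M "dyadic_cell n a l" "2 ^ n" f s B p m
  proof
    show "s \<le> 1 / (8 * 2 ^ n)" using s(2) by (simp add: power_add mult.commute)
    fix d c assume "measure M {x \<in> space M. \<bar>f x - ereal c\<bar> > ereal d} < s * measure M (space M)"
    then show "\<bar>m - c\<bar> \<le> d"
      using close[of d c] unfolding sp W_def[symmetric] m by auto
  qed (use fM p s JN(2) bound in auto)
  \<comment> \<open>Return to the closed cube; its boundary part outside \<open>\<Omega>\<close> is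
    null.\<close>
  have "{x \<in> cube n a l. \<bar>f x - ereal m\<bar> > ereal u} \<subseteq> large u \<union> (cube n a l - \<Omega>)"
    by (auto simp: large_def sp)
  then have "emeasure (leb n) {x \<in> cube n a l. \<bar>f x - ereal m\<bar> > ereal u} \<le> emeasure (leb n) (large u \<union> (cube n a l - \<Omega>))"
    using superlevel_subset_sets(2)[OF \<Omega>] \<Omega>(1) cube_in_sets
    by (intro emeasure_mono) (auto simp: large_def sp)
  also have "\<dots> = emeasure (leb n) (large u)"
    using superlevel_subset_sets(2)[OF \<Omega>] cube_minus_half_open_null[of l n a] l
    by (intro emeasure_Un_null_set) (auto simp: large_def sp \<Omega>_def)
  also have "\<dots> = ennreal (measure M (large u))"
    using emeasure_leb_eq[of "large u" n a l] l meas[of "large u"] by (auto simp: large_def sp \<Omega>_def)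
  also have "\<dots> \<le> ennreal (4 * (2 * \<theta> / (\<theta> - 1)) powr p * (B / u powr p))"
    using weak_type[OF u] unfolding \<theta>_def by (rule ennreal_leI)
  also have "\<dots> = ennreal (4 * (2 * \<theta> / (\<theta> - 1)) powr p) * ennreal B / ennreal (u powr p)"
    using JN(2) u by (simp add: divide_ennreal[symmetric] ennreal_mult ennreal_times_divide)
  finally show ?thesis unfolding m JN(1) .
qed

end

theorem theorem3p5:
  fixes p :: real
  assumes "1 < p"
  shows "\<exists>c::real. c > 0 \<and>
    (\<forall>(n::nat) (Q0 :: (nat \<Rightarrow> real) set) (s::real) (r::real) (f :: (nat \<Rightarrow> real) \<Rightarrow> ereal).
      n \<ge> 1 \<longrightarrow> is_cube n Q0 \<longrightarrow>
      0 < s \<longrightarrow> s \<le> 1 / 2 ^ (n + 3) \<longrightarrow> s \<le> r \<longrightarrow> r \<le> 1 / 2 \<longrightarrow>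
      f \<in> JN_space n p s Q0 \<longrightarrow>
      (\<forall>t::real. t > 0 \<longrightarrow>
        emeasure (leb n) {x \<in> Q0. \<bar>f x - maximal_median n r f Q0\<bar> > ereal t}
          \<le> ennreal c * epowr (JN_norm n p s Q0 f) p / ennreal (t powr p)))"
proof -
  \<comment> \<open>The constant is fixed here from p alone, before the dimension is
    introduced.\<close>
  define \<theta> :: real where "\<theta> = (3 / 2) powr (1 / p)"
  have "1 < \<theta>" using assms by (simp add: \<theta>_def)
  then have "0 < 4 * (2 * \<theta> / (\<theta> - 1)) powr p" by simp
  moreover have "emeasure (leb n) {x \<in> Q0. \<bar>f x - maximal_median n r f Q0\<bar> > ereal t}
      \<le> ennreal (4 * (2 * \<theta> / (\<theta> - 1)) powr p) * epowr (JN_norm n p s Q0 f) p / ennreal (t powr p)"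
    if Q0: "is_cube n Q0" and s: "0 < s" "s \<le> 1 / 2 ^ (n + 3)" "s \<le> r" "r \<le> 1 / 2"
      and f: "f \<in> JN_space n p s Q0" and t: "0 < t" for n Q0 s r t and f :: "(nat \<Rightarrow> real) \<Rightarrow> ereal"
  proof -
    obtain a l where l: "0 < l" and Q: "Q0 = cube n a l" using Q0 by (auto simp: is_cube_def)
    have fm: "f \<in> borel_measurable (restrict_space (leb n) (cube n a l))"
      and norm: "JN_norm n p s Q0 f < \<infinity>"
      using f by (auto simp: JN_space_def Q)
    have "0 < p" using assms by simp
    note JN = epowr_JN_norm[OF this norm]
    show ?thesis
      using weak_type_median[OF l fm assms s t JN(1)[unfolded Q]]
      unfolding JN(2) unfolding Q \<theta>_def .
  qed
  ultimately show ?thesis by blast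
qed

end
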